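(* Let $d\ge 1$, $p\in(1,+\infty)$, and let $\mathsf{c}:(0,1)\times \mathbb{R}^d \times \mathrm{Sym}^d_+ \to \mathbb{R} \cup \{+\infty\}$ be a Borel, $p$-admissible cost. Let $\varphi \in C^{1,2}_b([0,1]\times\mathbb{R}^d)$ solve $$\partial_t \varphi(t,x) = -\mathsf{c}^*\left(t,x, \tfrac12 \nabla^2 \varphi(t,x)\right)\qquad\text{for every }(t,x)\in(0,1)\times\mathbb{R}^d,$$ set $$a_t(x):=\nabla_{u} \mathsf{c}^*\left(t,x,\tfrac12\nabla^2\varphi(t,x)\right) \quad \text{for } (t,x) \in (0,1) \times \mathbb{R}^d,$$ and let $(\varrho_t)_{t\in [0,1]}\subset \mathcal{P}_2(\mathbb{R}^d)$ be a solution to the Fokker–Planck equation $\partial_t \varrho = \mathrm{Tr}(\frac12\nabla^2 a\varrho)$ in $(0,1)\times\mathbb{R}^d$ with this diffusion coefficient $a$. Then $(\varrho_t)_{t\in [0,1]}$ (with coefficient $a$) is a minimizer in the problem defining $\mathsf{c}_{FPE}(\varrho_0,\varrho_1)$; more generally, for every $s \le t$ in $[0,1]$, $$\mathsf{c}_{FPE}^{[s,t]}(\varrho_s, \varrho_t) = \int_s^t \int_{\mathbb{R}^d} \mathsf{c}(r,x, a_r(x))\, d \varrho_r (x)\, d r.$$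
   Context: $\mathrm{Sym}^d$ is the space of symmetric real $d\times d$ matrices, with norm $|a|=\sqrt{\mathrm{Tr}(a^2)}$, and $\mathrm{Sym}^d_+$ is its subset of non-negative definite matrices. $\mathcal{P}_2(\mathbb{R}^d)$ is the set of Borel probability measures on $\mathbb{R}^d$ with finite second moment, with the topology of narrow convergence together with convergence of second moments. Costs. The partial Legendre transform is $\mathsf{c}^*(t,x,u)=\sup_{a\in\mathrm{Sym}^d_+}\{\mathrm{Tr}(au)-\mathsf{c}(t,x,a)\}$ for $u\in\mathrm{Sym}^d$. $\mathsf{c}$ is $p$-admissible if $a\mapsto \mathsf{c}(t,x,a)$ is strictly convex on $\mathrm{Sym}^d_+$ for every $(t,x)$, and there are constants $\lambda,\lambda'>0$ (independent of $(t,x)$) with $\lambda|a|^p\le \mathsf{c}(t,x,a)\le\lambda'|a|^p$ for all $(t,x,a)$. In this case $u\mapsto\mathsf{c}^*(t,x,u)$ is continuously differentiable with gradient $\nabla_u\mathsf{c}^*(t,x,u)\in\mathrm{Sym}^d_+$. $C^{1,2}_b([0,1]\times\mathbb{R}^d)$ is the space of continuous functions $\varphi(t,x)=\varphi_t(x)$ on $[0,1]\times\mathbb{R}^d$, continuously differentiable once in $t$ and twice in $x$ in $(0,1)\times\mathbb{R}^d$, with $\partial_t\varphi,\nabla^2\varphi$ uniformly bounded. Fokker–Planck equation. For a continuous curve $(\varrho_t)_{t\in[0,1]}\subseteq\mathcal{P}_2(\mathbb{R}^d)$ and a Borel map $a:(0,1)\times\mathbb{R}^d\to\mathrm{Sym}^d_+$,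 the equation $\partial_t \varrho = \mathrm{Tr}(\frac12\nabla^2 a\varrho)$ in $(0,1)\times\mathbb{R}^d$ holds if $\int_0^1\int_{\mathbb{R}^d}|a_t|\,d\varrho_t\,dt<\infty$ and for every $\varphi\in C^{1,2}_b([0,1]\times\mathbb{R}^d)$ $$\int_0^1 \int_{\mathbb{R}^d} \left( \partial_t \varphi + \mathrm{Tr}\left(\tfrac12 a_t \nabla^2 \varphi \right)\right) d \varrho_t\, d t = \int_{\mathbb{R}^d} \varphi_1\, d \varrho_1 - \int_{\mathbb{R}^d} \varphi_0\, d \varrho_0.$$ The notion on $(s,t)\times\mathbb{R}^d$ is the same with $[0,1]$ replaced by $[s,t]$. Transport problem. For $\mu,\nu\in\mathcal{P}_2(\mathbb{R}^d)$ and $0\le s\le t\le1$, $\mathsf{c}_{FPE}^{[s,t]}(\mu,\nu)$ is the infimum of $\int_s^t \int_{\mathbb{R}^d} \mathsf{c}(r, x, \tilde a_r(x))\, d \tilde\varrho_r(x)\, d r$ over all pairs $(\tilde\varrho,\tilde a)$ solving $\partial_r \tilde\varrho = \mathrm{Tr}(\tfrac12 \nabla^2 \tilde a \tilde\varrho)$ in $(s,t)\times\mathbb{R}^d$ with $\tilde\varrho_s =\mu$, $\tilde\varrho_t = \nu$; $\mathsf{c}_{FPE}:=\mathsf{c}_{FPE}^{[0,1]}$.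
   Formalization: The formal theorem additionally assumes that a ↦ c(t,x,a) is lower semicontinuous on Sym^d_+ for every (t,x); without this the claim fails for d ≥ 2 (costs raised on an extreme ray of Sym^d_+). *)

theory Defs
  imports "HOL-Probability.Probability"
begin

section \<open>Symmetric matrices\<close>

definition Sym :: "(real^'n^'n) set" where
  "Sym = {a. transpose a = a}"

definition Sym_nonneg :: "(real^'n^'n) set" where
  "Sym_nonneg = {a \<in> Sym. \<forall>x. 0 \<le> x \<bullet> (a *v x)}"

text \<open>The library norm of \<^typ>\<open>real^'n^'n\<close> is the Frobenius norm.\<close>

lemma norm_Sym:
  fixes a :: "real^'n^'n"
  assumes "a \<in> Sym"
  shows "norm a = sqrt (trace (a ** a))"
proof -
  have sym: "a $ j $ i = a $ i $ j" for i j
  proof -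
    have "transpose a $ i $ j = a $ i $ j"
      using assms by (simp add: Sym_def)
    then show ?thesis
      by (simp add: transpose_def)
  qed
  have "trace (a ** a) = (\<Sum>i\<in>UNIV. \<Sum>j\<in>UNIV. a $ i $ j * a $ j $ i)"
    by (simp add: trace_def matrix_matrix_mult_def)
  also have "\<dots> = (\<Sum>i\<in>UNIV. \<Sum>j\<in>UNIV. a $ i $ j * a $ i $ j)"
    by (intro sum.cong refl arg_cong2[where f = "(*)"] sym)
  also have "\<dots> = a \<bullet> a"
    by (simp add: inner_vec_def)
  finally have "trace (a ** a) = a \<bullet> a" .
  then show ?thesis
    by (simp add: norm_eq_sqrt_inner)
qed

text \<open>The gradient of a function on the space \<^const>\<open>Sym\<close> with the scalar product
  $\mathrm{Tr}(gv)$; the derivative is taken along \<^const>\<open>Sym\<close> only.\<close>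

definition gradient_Sym :: "(real^'n^'n \<Rightarrow> real) \<Rightarrow> real^'n^'n \<Rightarrow> real^'n^'n" where
  "gradient_Sym f u =
    (THE g. g \<in> Sym \<and> (f has_derivative (\<lambda>v. trace (g ** v))) (at u within Sym))"

section \<open>Costs\<close>

type_synonym 'n cost = "real \<Rightarrow> real^'n \<Rightarrow> real^'n^'n \<Rightarrow> ereal"

text \<open>Costs are only relevant on $(0,1)\times\mathbb{R}^d\times\mathrm{Sym}^d_+$; no condition
  below looks at their values elsewhere.\<close>

definition borel_cost :: "('n::finite) cost \<Rightarrow> bool" where
  "borel_cost c \<longleftrightarrow>
    (\<forall>t\<in>{0<..<1}. \<forall>x. \<forall>a\<in>Sym_nonneg. c t x a \<noteq> -\<infinity>) \<and>
    (\<lambda>(t, x, a). c t x a) \<in> borel_measurable (restrict_space borel ({0<..<1} \<times> UNIV \<times> Sym_nonneg))"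

definition cost_conj :: "('n::finite) cost \<Rightarrow> 'n cost" where
  "cost_conj c t x u = (SUP a\<in>Sym_nonneg. ereal (trace (a ** u)) - c t x a)"

definition p_admissible :: "real \<Rightarrow> ('n::finite) cost \<Rightarrow> bool" where
  "p_admissible p c \<longleftrightarrow>
    (\<forall>t\<in>{0<..<1}. \<forall>x. \<forall>a\<in>Sym_nonneg. \<forall>b\<in>Sym_nonneg. \<forall>\<theta>\<in>{0<..<1}. a \<noteq> b \<longrightarrow>
      c t x ((1 - \<theta>) *\<^sub>R a + \<theta> *\<^sub>R b) < ereal (1 - \<theta>) * c t x a + ereal \<theta> * c t x b) \<and>
    (\<exists>k K. 0 < k \<and> 0 < K \<and>
      (\<forall>t\<in>{0<..<1}. \<forall>x. \<forall>a\<in>Sym_nonneg.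
        ereal (k * norm a powr p) \<le> c t x a \<and> c t x a \<le> ereal (K * norm a powr p)))"

text \<open>Lower semicontinuity in the matrix variable, the usual convention for costs handled
  through their Legendre transform. It is not implied by admissibility if $d \ge 2$: replacing
  $|a|^p$ by a multiple $k(t,x)\,|a|^p$ with $1 \le k \le 2$ on the extreme ray spanned by one
  rank-one matrix keeps the cost admissible and does not change its Legendre transform, but for
  such costs a Fokker--Planck solution driven by the gradient of the transform need not be minimal.\<close>

definition lsc_cost :: "('n::finite) cost \<Rightarrow> bool" where
  "lsc_cost c \<longleftrightarrow>
    (\<forall>t\<in>{0<..<1}. \<forall>x. \<forall>a\<in>Sym_nonneg. c t x a \<le> Liminf (at a within Sym_nonneg) (c t x))"

section \<open>Test functions\<close>

definition gradient :: "(real^'n \<Rightarrow> real) \<Rightarrow> real^'n \<Rightarrow> real^'n" where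
  "gradient f x = (THE g. GDERIV f x :> g)"

definition hessian :: "(real^'n \<Rightarrow> real) \<Rightarrow> real^'n \<Rightarrow> real^'n^'n" where
  "hessian f x = jacobian (gradient f) (at x)"

definition dt :: "(real \<Rightarrow> real^'n \<Rightarrow> real) \<Rightarrow> real \<Rightarrow> real^'n \<Rightarrow> real" where
  "dt \<phi> r x = deriv (\<lambda>r. \<phi> r x) r"

definition C12b :: "real \<Rightarrow> real \<Rightarrow> (real \<Rightarrow> real^'n \<Rightarrow> real) \<Rightarrow> bool" where
  "C12b s t \<phi> \<longleftrightarrow>
    continuous_on ({s..t} \<times> UNIV) (\<lambda>(r, x). \<phi> r x) \<and>
    (\<forall>r\<in>{s<..<t}. \<forall>x.
      (\<lambda>r. \<phi> r x) differentiable at r \<and>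
      \<phi> r differentiable at x \<and>
      gradient (\<phi> r) differentiable at x) \<and>
    continuous_on ({s<..<t} \<times> UNIV) (\<lambda>(r, x). dt \<phi> r x) \<and>
    continuous_on ({s<..<t} \<times> UNIV) (\<lambda>(r, x). gradient (\<phi> r) x) \<and>
    continuous_on ({s<..<t} \<times> UNIV) (\<lambda>(r, x). hessian (\<phi> r) x) \<and>
    bounded ((\<lambda>(r, x). dt \<phi> r x) ` ({s<..<t} \<times> UNIV)) \<and>
    bounded ((\<lambda>(r, x). hessian (\<phi> r) x) ` ({s<..<t} \<times> UNIV))"

section \<open>The space $\mathcal{P}_2(\mathbb{R}^d)$\<close>

definition P2 :: "(real^'n) measure set" where
  "P2 = {M. sets M = sets borel \<and> prob_space M \<and> integrable M (\<lambda>x. (norm x)\<^sup>2)}"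

text \<open>The coarsest topology for which the integrals of all bounded continuous functions
  and the second moment are continuous.\<close>

definition P2_topology :: "(real^'n) measure topology" where
  "P2_topology = topology_generated_by
    {{M \<in> P2. (LINT x|M. f x) \<in> U} | f U. open U \<and>
      (f = (\<lambda>x. (norm x)\<^sup>2) \<or> (continuous_on UNIV f \<and> bounded (range f)))}"

lemma continuous_map_P2_topology_iff:
  fixes \<rho> :: "'a \<Rightarrow> (real^'n) measure"
  shows "continuous_map X P2_topology \<rho> \<longleftrightarrow>
    \<rho> ` topspace X \<subseteq> P2 \<and>
    continuous_map X euclideanreal (\<lambda>r. LINT x|\<rho> r. (norm x)\<^sup>2) \<and>
    (\<forall>f. continuous_on UNIV f \<and> bounded (range f) \<longrightarrow>
      continuous_map X euclideanreal (\<lambda>r. LINT x|\<rho> r. f x))"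
  (is "?L \<longleftrightarrow> ?R")
proof -
  define F where "F f \<longleftrightarrow> f = (\<lambda>x. (norm x)\<^sup>2) \<or> (continuous_on UNIV f \<and> bounded (range f))"
    for f :: "real^'n \<Rightarrow> real"
  define B :: "(real^'n) measure set set"
    where "B = {{M \<in> P2. (LINT x|M. f x) \<in> U} | f U. open U \<and> F f}"
  have top: "P2_topology = topology_generated_by B"
    unfolding P2_topology_def B_def F_def ..
  have memB: "{M \<in> P2. (LINT x|M. f x) \<in> U} \<in> B" if "open U" "F f" for f U
    using that by (auto simp: B_def)
  have "F (\<lambda>x. (norm x)\<^sup>2)"
    by (simp add: F_def)
  from memB[OF open_UNIV this] have "P2 \<in> B"
    by simp
  moreover have "V \<subseteq> P2" if "V \<in> B" for V
    using that by (auto simp: B_def)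
  ultimately have P2_B: "\<Union> B = P2"
    by blast
  have "?L \<longleftrightarrow> (\<forall>V\<in>B. openin X (\<rho> -` V \<inter> topspace X)) \<and> \<rho> ` topspace X \<subseteq> P2"
    unfolding top continuous_on_generated_topo_iff P2_B by auto
  also have "\<dots> \<longleftrightarrow> \<rho> ` topspace X \<subseteq> P2 \<and>
      (\<forall>f. F f \<longrightarrow> continuous_map X euclideanreal (\<lambda>r. LINT x|\<rho> r. f x))"
  proof (cases "\<rho> ` topspace X \<subseteq> P2")
    case True
    then have eq: "\<rho> -` {M \<in> P2. (LINT x|M. f x) \<in> U} \<inter> topspace X =
        {r \<in> topspace X. (LINT x|\<rho> r. f x) \<in> U}" for f U
      by auto
    have "(\<forall>V\<in>B. openin X (\<rho> -` V \<inter> topspace X)) \<longleftrightarrow>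
        (\<forall>f U. open U \<and> F f \<longrightarrow> openin X {r \<in> topspace X. (LINT x|\<rho> r. f x) \<in> U})"
    proof (intro iffI allI impI ballI)
      fix f :: "real^'n \<Rightarrow> real" and U :: "real set"
      assume "\<forall>V\<in>B. openin X (\<rho> -` V \<inter> topspace X)" "open U \<and> F f"
      then show "openin X {r \<in> topspace X. (LINT x|\<rho> r. f x) \<in> U}"
        using memB[of U f] unfolding eq[symmetric] by blast
    next
      fix V
      assume *: "\<forall>f U. open U \<and> F f \<longrightarrow> openin X {r \<in> topspace X. (LINT x|\<rho> r. f x) \<in> U}"
        and "V \<in> B"
      then obtain f U where "V = {M \<in> P2. (LINT x|M. f x) \<in> U}" "open U" "F f"
        by (auto simp: B_def)
      then show "openin X (\<rho> -` V \<inter> topspace X)"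
        using * by (simp only: eq)
    qed
    then show ?thesis
      using True by (simp add: continuous_map_def) blast
  next
    case False
    then show ?thesis by simp
  qed
  also have "\<dots> \<longleftrightarrow> ?R"
    unfolding F_def by metis
  finally show ?thesis .
qed

section \<open>The Fokker--Planck equation and the transport problem\<close>

definition FPE_solution ::
    "real \<Rightarrow> real \<Rightarrow> (real \<Rightarrow> (real^'n) measure) \<Rightarrow> (real \<Rightarrow> real^'n \<Rightarrow> real^'n^'n) \<Rightarrow> bool" where
  "FPE_solution s t \<rho> a \<longleftrightarrow>
    continuous_map (top_of_set {s..t}) P2_topology \<rho> \<and>
    (\<forall>r\<in>{s<..<t}. \<forall>x. a r x \<in> Sym_nonneg) \<and>
    (\<lambda>(r, x). a r x) \<in> borel_measurable (restrict_space borel ({s<..<t} \<times> UNIV)) \<and>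
    (\<integral>\<^sup>+r\<in>{s<..<t}. (\<integral>\<^sup>+x. ennreal (norm (a r x)) \<partial>\<rho> r) \<partial>lborel) < \<infinity> \<and>
    (\<forall>\<phi>. C12b s t \<phi> \<longrightarrow>
      (LINT r:{s<..<t}|lborel. LINT x|\<rho> r.
        dt \<phi> r x + trace (((1/2) *\<^sub>R a r x) ** hessian (\<phi> r) x)) =
      (LINT x|\<rho> t. \<phi> t x) - (LINT x|\<rho> s. \<phi> s x))"

text \<open>Admissible costs are nonnegative, so the truncation of negative values by
  \<^const>\<open>e2ennreal\<close> has no effect on them.\<close>

definition FPE_cost ::
    "('n::finite) cost \<Rightarrow> real \<Rightarrow> real \<Rightarrow> (real \<Rightarrow> (real^'n) measure) \<Rightarrow>
      (real \<Rightarrow> real^'n \<Rightarrow> real^'n^'n) \<Rightarrow> ennreal" where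
  "FPE_cost c s t \<rho> a =
    (\<integral>\<^sup>+r\<in>{s<..<t}. (\<integral>\<^sup>+x. e2ennreal (c r x (a r x)) \<partial>\<rho> r) \<partial>lborel)"

text \<open>Curves are total functions of time; only their values on $[s,t]$ matter.\<close>

definition FPE_competitor ::
    "real \<Rightarrow> real \<Rightarrow> (real^'n) measure \<Rightarrow> (real^'n) measure \<Rightarrow>
      (real \<Rightarrow> (real^'n) measure) \<times> (real \<Rightarrow> real^'n \<Rightarrow> real^'n^'n) \<Rightarrow> bool" where
  "FPE_competitor s t \<mu> \<nu> = (\<lambda>(\<rho>, a). FPE_solution s t \<rho> a \<and> \<rho> s = \<mu> \<and> \<rho> t = \<nu>)"

definition c_FPE ::
    "('n::finite) cost \<Rightarrow> real \<Rightarrow> real \<Rightarrow> (real^'n) measure \<Rightarrow> (real^'n) measure \<Rightarrow> ennreal" where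
  "c_FPE c s t \<mu> \<nu> = (INF (\<rho>, a) \<in> Collect (FPE_competitor s t \<mu> \<nu>). FPE_cost c s t \<rho> a)"

end

theory Submission
  imports Defs "HOL-Real_Asymp.Real_Asymp"
begin

text \<open>
  Testing the equation of a competitor with $\varphi$ and using the Fenchel--Young inequality
  $\mathsf{c}(a) \ge \mathrm{Tr}(au) - \mathsf{c}^*(u)$ at $u = \frac12\nabla^2\varphi$ bounds its cost from
  below by $\int \varphi_t\,d\varrho_t - \int \varphi_s\,d\varrho_s$. For $a = \nabla_u\mathsf{c}^*(u)$ the
  inequality is an equality, because this gradient is the unique maximiser in the definition of
  $\mathsf{c}^*(u)$ (an envelope argument, resting on strict convexity, lower semicontinuity and
  superlinear growth), so the bound is attained.

  Attainment on $[s,t]$ requires that the equation on $(0,1)$ localises to $(s,t)$. A test function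
  on $[s,t]$ may be assumed non-negative after adding a multiple of $1 + |x|^2$. A cut-off
  in time alone destroys the bound on $\partial_t$ if $\psi$ is unbounded, hence $\psi$ is first
  replaced by $\psi/(1 + \varepsilon\psi)$. The Hessian of the latter is bounded uniformly in
  $\varepsilon$ because a non-negative function with Hessian bounded by $L$ satisfies
  $|\nabla\psi|^2 \le 4L\psi$.
\<close>

text \<open>The two halves of the comparison differ in difficulty. A competitor already solves the
  equation on (s,t), and its integrand is compared with the cost only after truncation at zero, so
  no integrability has to be established for it. The optimal curve solves the equation on (0,1), and
  a test function on [s,t] says nothing outside that interval; it therefore has to vanish near s and
  t before it can be extended by zero, and the boundary terms must come back as a limit. They come
  back through \<eta>': it is a difference of two approximate identities at s and t, and they
  recover the end values because the integral of the saturated test function against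
  \<open>\<rho> r\<close> is continuous in r. Narrow continuity gives this only for bounded
  integrands, which fixes the order of limits: the cut-off is sharpened at fixed \<epsilon>, and
  \<epsilon> tends to 0 afterwards, dominated by a multiple of 1 + |a|. To run these limits by
  dominated convergence, the curve is assembled into one finite measure on space-time. Gradients of
  the conjugate are taken along \<open>Sym\<close> only, so half the Hessian must be shown to lie
  there; hence the proof of Schwarz's theorem.\<close>

section \<open>Trace pairing and the cone of non-negative matrices\<close>

lemma trace_mult_Sym:
  fixes a b :: "real^'n^'n"
  assumes "a \<in> Sym"
  shows "trace (a ** b) = a \<bullet> b"
proof -
  have sym: "a $ i $ j = a $ j $ i" for i j
    using assms by (auto simp: Sym_def transpose_def vec_eq_iff)
  have "trace (a ** b) = (\<Sum>i\<in>UNIV. \<Sum>j\<in>UNIV. a $ i $ j * b $ j $ i)"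
    by (simp add: trace_def matrix_matrix_mult_def)
  also have "\<dots> = (\<Sum>j\<in>UNIV. \<Sum>i\<in>UNIV. a $ i $ j * b $ j $ i)"
    by (rule sum.swap)
  also have "\<dots> = a \<bullet> b"
    unfolding inner_vec_def inner_real_def by (intro sum.cong refl arg_cong2[where f="(*)"] sym)
  finally show ?thesis .
qed

lemma trace_mult_half_Sym:
  fixes a b :: "real^'n^'n"
  assumes "a \<in> Sym"
  shows "trace (((1/2) *\<^sub>R a) ** b) = a \<bullet> ((1/2) *\<^sub>R b)"
proof -
  have "(1/2) *\<^sub>R a \<in> Sym"
    using assms by (simp add: Sym_def transpose_scalar)
  then show ?thesis by (simp add: trace_mult_Sym)
qed

lemma closed_Sym_nonneg: "closed (Sym_nonneg :: (real^'n^'n) set)"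
proof -
  have eq: "Sym_nonneg = (\<Inter>i j. {a :: real^'n^'n. a $ i $ j = a $ j $ i}) \<inter> (\<Inter>x. {a. 0 \<le> x \<bullet> (a *v x)})"
    by (auto simp: Sym_nonneg_def Sym_def transpose_def vec_eq_iff)
  have c1: "closed {a :: real^'n^'n. 0 \<le> x \<bullet> (a *v x)}" for x
    unfolding inner_vec_def matrix_vector_mult_def
    by (intro closed_Collect_le continuous_intros) 
  have c2: "closed {a :: real^'n^'n. a $ i $ j = a $ j $ i}" for i j
    by (intro closed_Collect_eq continuous_intros)
  show ?thesis
    unfolding eq by (intro closed_Int closed_INT ballI c1 c2)
qed

lemma zero_in_Sym_nonneg: "0 \<in> Sym_nonneg"
  by (simp add: Sym_nonneg_def Sym_def transpose_def vec_eq_iff)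

lemma convex_Sym_nonneg: "convex (Sym_nonneg :: (real^'n^'n) set)"
  unfolding convex_def Sym_nonneg_def Sym_def
  by (auto simp: transpose_def vec_eq_iff matrix_vector_mult_add_rdistrib inner_add_right
      scaleR_matrix_vector_assoc[symmetric])

section \<open>Conjugates of superlinear functions\<close>

text \<open>For p > 1 the power eventually beats the linear term. The level -1 instead of 0 leaves
  room for near-maximisers whose error is at most 1.\<close>

lemma superlevel_bounded:
  fixes p k R :: real
  assumes "1 < p" "0 < k"
  obtains B where "0 \<le> B" "\<And>x. 0 \<le> x \<Longrightarrow> - 1 \<le> R * x - k * x powr p \<Longrightarrow> x \<le> B"
proof -
  have "filterlim (\<lambda>x. k * x powr p - R * x) at_top at_top"
    using assms by real_asymp
  then have "eventually (\<lambda>x. 1 < k * x powr p - R * x) at_top"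
    by (simp add: filterlim_at_top_dense)
  then obtain N where N: "\<And>x. N \<le> x \<Longrightarrow> 1 < k * x powr p - R * x"
    by (auto simp: eventually_at_top_linorder)
  show thesis
  proof (rule that[of "max 0 N"])
    fix x assume "- 1 \<le> R * x - k * x powr p"
    then show "x \<le> max 0 N" using N[of x] by (cases "N \<le> x") auto
  qed simp
qed

text \<open>A cost at fixed (t,x), seen as a real function on a closed convex set of a Euclidean
  space with the inner product in place of the trace. \<open>F 0 = 0\<close> records that the two
  growth bounds meet at 0; it makes every conjugate value non-negative.\<close>

locale superlinear_lsc =
  fixes S :: "'a::euclidean_space set" and F :: "'a \<Rightarrow> real" and p k :: real
  assumes closed: "closed S"
    and convex: "convex S"
    and zero: "0 \<in> S" "F 0 = 0"
    and strict: "\<And>a b \<theta>. a \<in> S \<Longrightarrow> b \<in> S \<Longrightarrow> a \<noteq> b \<Longrightarrow> 0 < \<theta> \<Longrightarrow> \<theta> < 1 \<Longrightarrow>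
      F ((1 - \<theta>) *\<^sub>R a + \<theta> *\<^sub>R b) < (1 - \<theta>) * F a + \<theta> * F b"
    and lsc: "\<And>a y. a \<in> S \<Longrightarrow> y < F a \<Longrightarrow> eventually (\<lambda>b. y < F b) (at a within S)"
    and p: "1 < p" and k: "0 < k"
    and lower: "\<And>a. a \<in> S \<Longrightarrow> k * norm a powr p \<le> F a"
begin

definition maximizer :: "'a \<Rightarrow> 'a \<Rightarrow> bool" where
  "maximizer u a \<longleftrightarrow> a \<in> S \<and> (\<forall>b\<in>S. b \<bullet> u - F b \<le> a \<bullet> u - F a)"

text \<open>Uniform over the ball of radius R, because the derivative of the conjugate is found by
  following maximisers at points converging to u.\<close>

lemma superlevel_norm_le:
  obtains B where "0 \<le> B"
    "\<And>a u. a \<in> S \<Longrightarrow> norm u \<le> R \<Longrightarrow> - 1 \<le> a \<bullet> u - F a \<Longrightarrow> norm a \<le> B"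
proof -
  obtain B where B: "0 \<le> B" "\<And>x. 0 \<le> x \<Longrightarrow> - 1 \<le> R * x - k * x powr p \<Longrightarrow> x \<le> B"
    using superlevel_bounded[OF p k, of R] by blast
  show thesis
  proof (rule that[OF B(1)])
    fix a u assume a: "a \<in> S" "norm u \<le> R" "- 1 \<le> a \<bullet> u - F a"
    have "a \<bullet> u \<le> norm a * norm u" by (rule norm_cauchy_schwarz)
    also have "\<dots> \<le> R * norm a" using mult_right_mono[OF a(2), of "norm a"] by (simp add: mult.commute)
    finally show "norm a \<le> B" using B(2)[of "norm a"] lower[OF a(1)] a(3) by auto
  qed
qed

text \<open>Boundedness gives a convergent subsequence, closedness keeps its limit in S, and lower
  semicontinuity of F prevents the value from dropping in the limit. It serves both the existence of
  maximisers and their convergence under perturbation of u.\<close>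

lemma value_cluster:
  fixes b :: "nat \<Rightarrow> 'a"
  assumes b: "\<And>n. b n \<in> S" "bounded (range b)"
    and e: "\<And>n. m - e n \<le> b n \<bullet> u - F (b n)" "e \<longlonglongrightarrow> 0"
  obtains a r where "a \<in> S" "strict_mono (r :: nat \<Rightarrow> nat)" "(b \<circ> r) \<longlonglongrightarrow> a" "m \<le> a \<bullet> u - F a"
proof -
  obtain a r where ar: "strict_mono (r :: nat \<Rightarrow> nat)" "(b \<circ> r) \<longlonglongrightarrow> a"
    using bounded_imp_convergent_subsequence[OF b(2)] by blast
  have a: "a \<in> S"
    using closed_sequentially[OF closed _ ar(2)] b(1) by simp
  have "m \<le> a \<bullet> u - F a"
  proof (rule ccontr)
    assume "\<not> ?thesis"
    then obtain y where y: "a \<bullet> u - m < y" "y < F a"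
      using dense[of "a \<bullet> u - m" "F a"] by auto
    from lsc[OF a y(2)] obtain d where d: "0 < d" "\<And>x. x \<in> S \<Longrightarrow> x \<noteq> a \<Longrightarrow> dist x a < d \<Longrightarrow> y < F x"
      unfolding eventually_at by auto
    have "eventually (\<lambda>n. dist ((b \<circ> r) n) a < d) sequentially"
      using ar(2) d(1) by (rule tendstoD)
    then have ev: "eventually (\<lambda>n. m - (e \<circ> r) n \<le> (b \<circ> r) n \<bullet> u - y) sequentially"
    proof eventually_elim
      case (elim n)
      \<comment> \<open>The filter \<open>at a within S\<close> ignores a itself; terms equal to a
        are covered by \<open>y < F a\<close>.\<close>
      then have "y < F (b (r n))"
        using d(2)[of "b (r n)"] b(1) y(2) by (cases "b (r n) = a") auto
      then show ?case using e(1)[of "r n"] by simp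
    qed
    have "(\<lambda>n. m - (e \<circ> r) n) \<longlonglongrightarrow> m - 0"
      by (intro tendsto_intros LIMSEQ_subseq_LIMSEQ e(2) ar(1))
    moreover have "(\<lambda>n. (b \<circ> r) n \<bullet> u - y) \<longlonglongrightarrow> a \<bullet> u - y"
      by (intro tendsto_intros ar(2))
    ultimately have "m - 0 \<le> a \<bullet> u - y"
      using ev by (intro tendsto_le[OF sequentially_bot])
    then show False using y(1) by simp
  qed
  with a ar that show thesis by blast
qed

lemma maximizer_value_nonneg: "maximizer u a \<Longrightarrow> 0 \<le> a \<bullet> u - F a"
  using zero by (force simp: maximizer_def)

text \<open>The direct method: m is finite by the growth bound and non-negative by comparison with
  0, so a maximising sequence with error 1/(n+1) \<le> 1 stays in the superlevel set at -1, which is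
  bounded.\<close>

lemma ex_maximizer: "\<exists>a. maximizer u a"
proof -
  obtain B where B: "0 \<le> B" "\<And>a v. a \<in> S \<Longrightarrow> norm v \<le> norm u \<Longrightarrow> - 1 \<le> a \<bullet> v - F a \<Longrightarrow> norm a \<le> B"
    using superlevel_norm_le by metis
  have F_nonneg: "0 \<le> F a" if "a \<in> S" for a
    using lower[OF that] k by (smt (verit) mult_nonneg_nonneg powr_ge_zero)
  have le: "a \<bullet> u - F a \<le> B * norm u" if "a \<in> S" for a
  proof (cases "- 1 \<le> a \<bullet> u - F a")
    case True
    then have "norm a * norm u \<le> B * norm u"
      using B(2)[OF that _ True] by (intro mult_right_mono) auto
    then show ?thesis using F_nonneg[OF that] norm_cauchy_schwarz[of a u] by linarith
  next
    case False
    moreover have "0 \<le> B * norm u" using B(1) by simp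
    ultimately show ?thesis by linarith
  qed
  define m where "m = (SUP a\<in>S. a \<bullet> u - F a)"
  have bdd: "bdd_above ((\<lambda>a. a \<bullet> u - F a) ` S)" using le by (auto intro!: bdd_aboveI2)
  have m_ub: "a \<bullet> u - F a \<le> m" if "a \<in> S" for a
    unfolding m_def using bdd that by (rule cSUP_upper2) simp
  have "0 \<le> m" using m_ub[OF zero(1)] zero(2) by simp
  have "\<exists>a\<in>S. m - 1 / real (Suc n) < a \<bullet> u - F a" for n
    using less_cSUP_iff[OF _ bdd, of "m - 1 / real (Suc n)"] zero(1) by (auto simp: m_def)
  then obtain b where b: "\<And>n. b n \<in> S" "\<And>n. m - 1 / real (Suc n) < b n \<bullet> u - F (b n)"
    by metis
  have "norm (b n) \<le> B" for n
  proof (rule B(2)[OF b(1) order_refl])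
    have "1 / real (Suc n) \<le> 1" by simp
    then show "- 1 \<le> b n \<bullet> u - F (b n)" using b(2)[of n] \<open>0 \<le> m\<close> by linarith
  qed
  then have "bounded (range b)" by (auto simp: bounded_iff)
  moreover have "(\<lambda>n. 1 / real (Suc n)) \<longlonglongrightarrow> 0"
    by (rule LIMSEQ_Suc[OF lim_1_over_n])
  ultimately obtain a where "a \<in> S" "m \<le> a \<bullet> u - F a"
    using value_cluster[OF b(1), where m = m and e = "\<lambda>n. 1 / real (Suc n)" and u = u, OF _ less_imp_le[OF b(2)]]
    by blast
  with m_ub show ?thesis by (auto simp: maximizer_def intro: order_trans)
qed

text \<open>By strict convexity the midpoint of two distinct maximisers would have a strictly larger
  value.\<close>

lemma maximizer_unique:
  assumes "maximizer u a" "maximizer u b"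
  shows "a = b"
proof (rule ccontr)
  assume "a \<noteq> b"
  let ?c = "(1 - 1/2) *\<^sub>R a + (1/2::real) *\<^sub>R b"
  have S: "a \<in> S" "b \<in> S" using assms by (auto simp: maximizer_def)
  have "?c \<in> S" using convex S by (intro convexD) auto
  then have "?c \<bullet> u - F ?c \<le> a \<bullet> u - F a" "?c \<bullet> u - F ?c \<le> b \<bullet> u - F b"
    using assms by (auto simp: maximizer_def)
  moreover have "F ?c < (1 - 1/2) * F a + 1/2 * F b"
    using strict[OF S \<open>a \<noteq> b\<close>, of "1/2"] by simp
  moreover have "?c \<bullet> u = (a \<bullet> u + b \<bullet> u) / 2"
    by (simp add: inner_add_left)
  ultimately show False by (simp add: field_simps)
qed

text \<open>If b maximises at w, comparing each maximiser at the other point gives 0 \<le> f w - f u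
  - a \<bullet> (w - u) \<le> (b - a) \<bullet> (w - u). So differentiability can fail only if
  maximisers at some w_n tending to u stay away from a; but they cluster at a maximiser for u, and a
  is the only one.\<close>

lemma conjugate_has_derivative:
  assumes f: "\<And>w a. maximizer w a \<Longrightarrow> f w = a \<bullet> w - F a"
    and a: "maximizer u a"
  shows "(f has_derivative (\<lambda>v. a \<bullet> v)) (at u)"
proof -
  have ub: "b \<bullet> w - F b \<le> f w" if "b \<in> S" for b w
    using ex_maximizer[of w] f that by (metis maximizer_def)
  have aS: "a \<in> S" using a by (simp add: maximizer_def)
  have "\<exists>d>0. \<forall>w. norm (w - u) < d \<longrightarrow> norm (f w - f u - a \<bullet> (w - u)) \<le> e * norm (w - u)"
    if e: "0 < e" for e
  proof (rule ccontr)
    assume "\<not> ?thesis"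
    then have "\<exists>w. norm (w - u) < 1 / real (Suc n) \<and> e * norm (w - u) < norm (f w - f u - a \<bullet> (w - u))" for n
      by (meson not_le of_nat_0_less_iff zero_less_Suc zero_less_divide_1_iff)
    then obtain w where w: "\<And>n. norm (w n - u) < 1 / real (Suc n)"
        "\<And>n. e * norm (w n - u) < norm (f (w n) - f u - a \<bullet> (w n - u))"
      by metis
    have "\<forall>n. \<exists>a. maximizer (w n) a" using ex_maximizer by blast
    then obtain b where b: "\<And>n. maximizer (w n) (b n)" by metis
    have bS: "b n \<in> S" for n using b[of n] by (simp add: maximizer_def)
    have fw: "f (w n) = b n \<bullet> w n - F (b n)" for n using f[OF b] .
    have fu: "f u = a \<bullet> u - F a" using f[OF a] .
    have low: "0 \<le> f (w n) - f u - a \<bullet> (w n - u)" for n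
      using ub[OF aS, of "w n"] fu by (simp add: inner_diff_right)
    have far: "e \<le> norm (b n - a)" for n
    proof -
      have "f (w n) - f u - a \<bullet> (w n - u) \<le> (b n - a) \<bullet> (w n - u)"
        using ub[OF bS, of n u] fw[of n] by (simp add: inner_diff_right inner_diff_left)
      also have "\<dots> \<le> norm (b n - a) * norm (w n - u)" by (rule norm_cauchy_schwarz)
      finally have "e * norm (w n - u) < norm (b n - a) * norm (w n - u)"
        using low[of n] w(2)[of n] by simp
      then show ?thesis by (meson mult_le_cancel_right norm_ge_zero not_le order_less_imp_le)
    qed
    \<comment> \<open>The radius \<open>norm u + 1\<close> contains every \<open>w n\<close>, since
      these lie within 1/(n+1) \<le> 1 of u.\<close>
    obtain B where B: "0 \<le> B" "\<And>c v. c \<in> S \<Longrightarrow> norm v \<le> norm u + 1 \<Longrightarrow> - 1 \<le> c \<bullet> v - F c \<Longrightarrow> norm c \<le> B"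
      using superlevel_norm_le by metis
    have "norm (w n) \<le> norm u + 1" for n
    proof -
      have "1 / real (Suc n) \<le> 1" by simp
      then show ?thesis using w(1)[of n] norm_triangle_sub[of "w n" u] by linarith
    qed
    then have bB: "norm (b n) \<le> B" for n
      using B(2)[OF bS] maximizer_value_nonneg[OF b] by (smt (verit))
    then have bdd: "bounded (range b)" by (auto simp: bounded_iff)
    \<comment> \<open>Replacing \<open>w n\<close> by u changes the comparison by at most |b n - a|
      |w n - u|, so \<open>b n\<close> nearly maximises at u itself.\<close>
    have near: "f u - (norm a + B) * (1 / real (Suc n)) \<le> b n \<bullet> u - F (b n)" for n
    proof -
      have "norm ((b n - a) \<bullet> (w n - u)) \<le> norm (b n - a) * norm (w n - u)"
        by (simp add: Cauchy_Schwarz_ineq2)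
      also have "\<dots> \<le> (norm a + B) * (1 / real (Suc n))"
        using w(1)[of n] bB[of n] norm_triangle_ineq4[of "b n" a] B(1)
        by (intro mult_mono) (auto intro: less_imp_le)
      finally show ?thesis
        using low[of n] fw[of n] by (simp add: inner_diff_right inner_diff_left)
    qed
    have lim: "(\<lambda>n. (norm a + B) * (1 / real (Suc n))) \<longlonglongrightarrow> 0"
      using tendsto_mult_right_zero[OF LIMSEQ_Suc[OF lim_1_over_n]] by blast
    obtain c r where c: "c \<in> S" "(b \<circ> r) \<longlonglongrightarrow> c" "f u \<le> c \<bullet> u - F c"
      using value_cluster[OF bS bdd near lim] by metis
    have "maximizer u c"
      using c ub by (auto simp: maximizer_def intro: order_trans)
    then have "c = a" using a by (rule maximizer_unique)
    have "(\<lambda>n. norm ((b \<circ> r) n - a)) \<longlonglongrightarrow> norm (c - a)"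
      by (intro tendsto_intros c)
    then have "e \<le> norm (c - a)"
      by (rule tendsto_lowerbound) (auto simp: far)
    with \<open>c = a\<close> e show False by simp
  qed
  then show ?thesis
    unfolding has_derivative_at_alt by (auto intro: bounded_linear_inner_right)
qed

end

text \<open>A derivative within \<open>Sym\<close> tests g only against symmetric directions. The
  difference v of two candidates is such a direction, and on the line u + z v, which stays in
  \<open>Sym\<close>, the one-variable derivative is unique; this yields v \<bullet> v = 0.\<close>

lemma gradient_Sym_eqI:
  fixes g u :: "real^'n^'n"
  assumes "g \<in> Sym" "u \<in> Sym" "(f has_derivative (\<lambda>v. g \<bullet> v)) (at u within Sym)"
  shows "gradient_Sym f u = g"
  unfolding gradient_Sym_def
proof (rule the_equality)
  show "g \<in> Sym \<and> (f has_derivative (\<lambda>v. trace (g ** v))) (at u within Sym)"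
    using assms by (simp add: trace_mult_Sym)
next
  fix h assume h: "h \<in> Sym \<and> (f has_derivative (\<lambda>v. trace (h ** v))) (at u within Sym)"
  define v where "v = h - g"
  have line: "u + z *\<^sub>R v \<in> Sym" for z
    using assms h by (auto simp: Sym_def v_def transpose_def vec_eq_iff)
  have deriv: "((\<lambda>z. f (u + z *\<^sub>R v)) has_derivative (\<lambda>z. k \<bullet> (z *\<^sub>R v))) (at 0)"
    if "(f has_derivative (\<lambda>v. k \<bullet> v)) (at u within Sym)" for k
  proof -
    have "((\<lambda>z. u + z *\<^sub>R v) has_derivative (\<lambda>z. z *\<^sub>R v)) (at 0 within UNIV)"
      by (auto intro!: derivative_eq_intros)
    then show ?thesis
    proof (rule has_derivative_in_compose)
      show "(f has_derivative (\<lambda>v. k \<bullet> v)) (at (u + 0 *\<^sub>R v) within range (\<lambda>z. u + z *\<^sub>R v))"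
        using has_derivative_subset[OF that, of "range (\<lambda>z. u + z *\<^sub>R v)"] line by auto
    qed
  qed
  have "(\<lambda>z. g \<bullet> (z *\<^sub>R v)) = (\<lambda>z. h \<bullet> (z *\<^sub>R v))"
  proof (rule has_derivative_unique[OF deriv[OF assms(3)] deriv])
    have "(\<lambda>v. trace (h ** v)) = (\<lambda>v. h \<bullet> v)"
      using h by (auto simp: trace_mult_Sym)
    then show "(f has_derivative (\<lambda>v. h \<bullet> v)) (at u within Sym)" using h by simp
  qed
  then have "g \<bullet> v = h \<bullet> v" by (metis scaleR_one)
  then have "v \<bullet> v = 0" by (simp add: v_def inner_diff_left)
  then show "h = g" by (simp add: v_def)
qed

section \<open>Gradients and Hessians\<close>

lemma gradientI: "GDERIV f x :> g \<Longrightarrow> gradient f x = g"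
  unfolding gradient_def gderiv_def
proof (rule the_equality)
  fix h assume "(f has_derivative (\<lambda>v. v \<bullet> g)) (at x)" "(f has_derivative (\<lambda>v. v \<bullet> h)) (at x)"
  then have "(\<lambda>v. v \<bullet> h) = (\<lambda>v. v \<bullet> g)" by (rule has_derivative_unique[rotated])
  then have "(h - g) \<bullet> h = (h - g) \<bullet> g" by meson
  then have "(h - g) \<bullet> (h - g) = 0" by (simp add: inner_diff_right)
  then show "h = g" by simp
qed

lemma gderiv_gradient:
  fixes f :: "real^'n \<Rightarrow> real"
  assumes "f differentiable (at x)"
  shows "GDERIV f x :> gradient f x"
proof -
  obtain D where D: "(f has_derivative D) (at x)"
    using assms by (auto simp: differentiable_def)
  then have lin: "linear D" by (rule has_derivative_linear)
  have "D v = v \<bullet> (\<Sum>b\<in>Basis. D b *\<^sub>R b)" for v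
  proof -
    have "D v = D (\<Sum>b\<in>Basis. (v \<bullet> b) *\<^sub>R b)" by (simp add: euclidean_representation)
    also have "\<dots> = (\<Sum>b\<in>Basis. (v \<bullet> b) * D b)"
      using lin by (simp add: linear_sum linear_scale)
    also have "\<dots> = v \<bullet> (\<Sum>b\<in>Basis. D b *\<^sub>R b)"
      by (simp add: inner_sum_right mult.commute)
    finally show ?thesis .
  qed
  then have "D = (\<lambda>v. v \<bullet> (\<Sum>b\<in>Basis. D b *\<^sub>R b))" by (rule ext)
  with D have "GDERIV f x :> (\<Sum>b\<in>Basis. D b *\<^sub>R b)"
    unfolding gderiv_def by simp
  with gradientI show ?thesis by metis
qed

lemma hessianI:
  assumes "(gradient f has_derivative (\<lambda>h. A *v h)) (at x)"
  shows "hessian f x = A"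
proof -
  have "frechet_derivative (gradient f) (at x) = (*v) A"
    using frechet_derivative_at[OF assms] by simp
  then show ?thesis
    unfolding hessian_def jacobian_def by (simp add: matrix_of_matrix_vector_mul)
qed

lemma has_derivative_hessian:
  "gradient f differentiable (at x) \<Longrightarrow> (gradient f has_derivative (\<lambda>h. hessian f x *v h)) (at x)"
  unfolding hessian_def by (simp add: jacobian_works)

lemma norm_matrix_vector_mult_le:
  fixes A :: "real^'n^'m"
  shows "norm (A *v x) \<le> norm A * norm x"
proof -
  have "norm (A *v x) \<le> L2_set (\<lambda>i. norm (A $ i) * norm x) UNIV"
    unfolding norm_vec_def[of "A *v x"]
    by (intro L2_set_mono) (auto simp: matrix_vector_mul_component Cauchy_Schwarz_ineq2)
  also have "\<dots> = norm A * norm x"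
    unfolding norm_vec_def[of A] by (simp add: L2_set_left_distrib)
  finally show ?thesis .
qed

text \<open>The rank-one tensor square of g; it enters the Hessian of a composition \<theta>(f) with
  the factor \<theta>''.\<close>

definition outer :: "real^'n \<Rightarrow> real^'n^'n" where
  "outer g = (\<chi> i j. g $ i * g $ j)"

lemma outer_mult: "outer g *v h = (g \<bullet> h) *\<^sub>R g"
  by (simp add: outer_def matrix_vector_mult_def vec_eq_iff inner_vec_def sum_distrib_right sum_distrib_left mult_ac)

lemma norm_outer: "norm (outer g) = (norm g)\<^sup>2"
proof -
  have "outer g $ i = g $ i *\<^sub>R g" for i by (simp add: outer_def vec_eq_iff)
  then have "norm (outer g) = L2_set (\<lambda>i. norm (g $ i) * norm g) UNIV"
    unfolding norm_vec_def[of "outer g"] by simp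
  also have "\<dots> = L2_set (\<lambda>i. norm (g $ i)) UNIV * norm g"
    by (rule L2_set_left_distrib[symmetric]) simp
  also have "\<dots> = norm g * norm g"
    by (simp only: norm_vec_def[of g, symmetric])
  finally show ?thesis by (simp add: power2_eq_square)
qed

lemma continuous_on_outer [continuous_intros]:
  "continuous_on S g \<Longrightarrow> continuous_on S (\<lambda>x. outer (g x))"
  unfolding outer_def by (intro continuous_intros)

section \<open>Mean value estimates and symmetry of the Hessian\<close>

locale twice_diff =
  fixes f :: "real^'n \<Rightarrow> real"
  assumes diff1: "\<And>x. f differentiable (at x)"
    and diff2: "\<And>x. gradient f differentiable (at x)"
begin

lemma line_derivative:
  "((\<lambda>z. f (x + z *\<^sub>R v)) has_real_derivative gradient f (x + z *\<^sub>R v) \<bullet> v) (at z)"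
proof -
  have "((\<lambda>z. x + z *\<^sub>R v) has_derivative (\<lambda>z. z *\<^sub>R v)) (at z)"
    by (auto intro!: derivative_eq_intros)
  from has_derivative_compose[OF this gderiv_gradient[OF diff1, unfolded gderiv_def]]
  show ?thesis
    unfolding has_field_derivative_def by (simp add: inner_commute mult_commute_abs)
qed

lemma line_derivative_gradient:
  "((\<lambda>z. gradient f (x + z *\<^sub>R w) \<bullet> v) has_real_derivative (hessian f (x + z *\<^sub>R w) *v w) \<bullet> v) (at z)"
proof -
  have "((\<lambda>z. x + z *\<^sub>R w) has_derivative (\<lambda>z. z *\<^sub>R w)) (at z)"
    by (auto intro!: derivative_eq_intros)
  from has_derivative_inner_left[OF has_derivative_compose[OF this has_derivative_hessian[OF diff2]]]
  show ?thesis
    unfolding has_field_derivative_def by (simp add: matrix_vector_mult_scaleR mult_commute_abs)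
qed

text \<open>One mean value step for f along the segment, then the Lipschitz bound for the gradient.
  This gives L where the sharp constant is L/2; the loss explains the 4 in
  \<open>gradient_sq_le\<close>.\<close>

lemma taylor_le:
  assumes L: "\<And>x. norm (hessian f x) \<le> L"
  shows "\<bar>f (x + h) - f x - gradient f x \<bullet> h\<bar> \<le> L * (norm h)\<^sup>2"
proof -
  obtain z where z: "0 < z" "z < 1" "f (x + 1 *\<^sub>R h) - f (x + 0 *\<^sub>R h) = (1 - 0) * (gradient f (x + z *\<^sub>R h) \<bullet> h)"
    using MVT2[of 0 1 "\<lambda>z. f (x + z *\<^sub>R h)" "\<lambda>z. gradient f (x + z *\<^sub>R h) \<bullet> h"] line_derivative
    by auto
  have "norm (gradient f (x + z *\<^sub>R h) - gradient f x) \<le> L * norm ((x + z *\<^sub>R h) - x)"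
  proof (rule differentiable_bound[where S = UNIV])
    fix y
    show "(gradient f has_derivative (\<lambda>h. hessian f y *v h)) (at y within UNIV)"
      using has_derivative_hessian[OF diff2] by simp
    show "onorm (\<lambda>h. hessian f y *v h) \<le> L"
      using L by (intro onorm_le) (meson norm_matrix_vector_mult_le mult_right_mono norm_ge_zero order_trans)
  qed auto
  also have "\<dots> \<le> L * norm h"
    using z order_trans[OF norm_ge_zero L[of x]]
    by (auto intro!: mult_left_mono mult_left_le_one_le)
  finally have g: "norm (gradient f (x + z *\<^sub>R h) - gradient f x) \<le> L * norm h" .
  have "f (x + h) - f x - gradient f x \<bullet> h = (gradient f (x + z *\<^sub>R h) - gradient f x) \<bullet> h"
    using z(3) by (simp add: inner_diff_left)
  also have "\<bar>\<dots>\<bar> \<le> norm (gradient f (x + z *\<^sub>R h) - gradient f x) * norm h"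
    by (rule Cauchy_Schwarz_ineq2)
  also have "\<dots> \<le> L * norm h * norm h"
    using g by (intro mult_right_mono) auto
  finally show ?thesis by (simp add: power2_eq_square)
qed

text \<open>Taylor expansion at the origin; quadratic growth is exactly what finite second moments
  can integrate.\<close>

lemma quadratic_growth:
  assumes L: "\<And>x. norm (hessian f x) \<le> L"
  obtains M where "0 \<le> M" "\<And>x. \<bar>f x\<bar> \<le> M * (1 + (norm x)\<^sup>2)"
proof (rule that)
  define M where "M = \<bar>f 0\<bar> + norm (gradient f 0) + L"
  have L0: "0 \<le> L" using L[of 0] norm_ge_zero[of "hessian f 0"] by linarith
  then show "0 \<le> M" by (simp add: M_def)
  fix x
  have "\<bar>f x\<bar> \<le> \<bar>f 0\<bar> + \<bar>gradient f 0 \<bullet> x\<bar> + L * (norm x)\<^sup>2"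
    using taylor_le[OF L, of 0 x] by simp
  also have "\<bar>gradient f 0 \<bullet> x\<bar> \<le> norm (gradient f 0) * norm x"
    by (rule Cauchy_Schwarz_ineq2)
  also have "\<dots> \<le> norm (gradient f 0) * (1 + (norm x)\<^sup>2)"
  proof (intro mult_left_mono)
    have "0 \<le> (norm x - 1/2)\<^sup>2" by simp
    then show "norm x \<le> 1 + (norm x)\<^sup>2" by (simp add: power2_eq_square algebra_simps)
  qed simp
  also have "\<bar>f 0\<bar> + \<dots> + L * (norm x)\<^sup>2 \<le> M * (1 + (norm x)\<^sup>2)"
    using L0 by (simp add: M_def algebra_simps)
  finally show "\<bar>f x\<bar> \<le> M * (1 + (norm x)\<^sup>2)" by simp
qed

text \<open>A step against the gradient cannot push a non-negative function below zero, while the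
  Taylor bound predicts a decrease of |gradient|^2 / (4 L).\<close>

lemma gradient_sq_le:
  assumes L: "\<And>x. norm (hessian f x) \<le> L" "0 < L" and nonneg: "\<And>x. 0 \<le> f x"
  shows "(norm (gradient f x))\<^sup>2 \<le> 4 * L * f x"
proof -
  \<comment> \<open>The minimiser of g \<bullet> h + L |h|^2 for g the gradient at x.\<close>
  define h where "h = (- 1 / (2 * L)) *\<^sub>R gradient f x"
  have "0 \<le> f (x + h)" by (rule nonneg)
  also have "\<dots> \<le> f x + gradient f x \<bullet> h + L * (norm h)\<^sup>2"
    using taylor_le[OF L(1), of x h] by linarith
  also have "gradient f x \<bullet> h = - (norm (gradient f x))\<^sup>2 / (2 * L)"
    by (simp add: h_def dot_square_norm)
  also have "L * (norm h)\<^sup>2 = (norm (gradient f x))\<^sup>2 / (4 * L)"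
    using L(2) by (simp add: h_def power_mult_distrib power_divide power2_eq_square field_simps)
  finally show ?thesis using L(2) by (simp add: field_simps)
qed

text \<open>The mean value theorem is applied along v to the increment in direction w, then along w
  to the resulting derivative. The left side is symmetric in v and w, the right side is not visibly
  so.\<close>

lemma second_difference:
  assumes "0 < h"
  obtains \<xi> \<eta> where "0 < \<xi>" "\<xi> < h" "0 < \<eta>" "\<eta> < h"
    "f (x + h *\<^sub>R v + h *\<^sub>R w) - f (x + h *\<^sub>R v) - f (x + h *\<^sub>R w) + f x =
      h * (h * ((hessian f (x + \<xi> *\<^sub>R v + \<eta> *\<^sub>R w) *v w) \<bullet> v))"
proof -
  let ?g = "\<lambda>z. f (x + h *\<^sub>R w + z *\<^sub>R v) - f (x + z *\<^sub>R v)"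
  have "(?g has_real_derivative gradient f (x + h *\<^sub>R w + z *\<^sub>R v) \<bullet> v - gradient f (x + z *\<^sub>R v) \<bullet> v) (at z)" for z
    by (intro DERIV_diff line_derivative)
  then obtain \<xi> where xi: "0 < \<xi>" "\<xi> < h"
    "?g h - ?g 0 = (h - 0) * (gradient f (x + h *\<^sub>R w + \<xi> *\<^sub>R v) \<bullet> v - gradient f (x + \<xi> *\<^sub>R v) \<bullet> v)"
    using MVT2[OF assms, of ?g "\<lambda>z. gradient f (x + h *\<^sub>R w + z *\<^sub>R v) \<bullet> v - gradient f (x + z *\<^sub>R v) \<bullet> v"]
    by blast
  obtain \<eta> where eta: "0 < \<eta>" "\<eta> < h"
    "gradient f (x + \<xi> *\<^sub>R v + h *\<^sub>R w) \<bullet> v - gradient f (x + \<xi> *\<^sub>R v + 0 *\<^sub>R w) \<bullet> v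
      = (h - 0) * ((hessian f (x + \<xi> *\<^sub>R v + \<eta> *\<^sub>R w) *v w) \<bullet> v)"
    using MVT2[OF assms, of "\<lambda>z. gradient f (x + \<xi> *\<^sub>R v + z *\<^sub>R w) \<bullet> v"
      "\<lambda>z. (hessian f (x + \<xi> *\<^sub>R v + z *\<^sub>R w) *v w) \<bullet> v"] line_derivative_gradient
    by blast
  show thesis
    using xi eta by (intro that[of \<xi> \<eta>]) (simp_all add: algebra_simps)
qed

text \<open>Schwarz's theorem: the same second difference computed in both orders gives Hessian
  values at two points near x, and both points tend to x as the step 1/(n+1) shrinks.\<close>

lemma hessian_Sym:
  assumes cont: "continuous_on UNIV (hessian f)"
  shows "hessian f x \<in> Sym"
proof -
  have sym: "(hessian f x *v w) \<bullet> v = (hessian f x *v v) \<bullet> w" for v w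
  proof -
    let ?h = "\<lambda>n. 1 / real (Suc n)"
    have h: "?h \<longlonglongrightarrow> 0" by (rule LIMSEQ_Suc[OF lim_1_over_n])
    have "\<exists>\<xi> \<eta> \<xi>' \<eta>'. 0 < \<xi> \<and> \<xi> < ?h n \<and> 0 < \<eta> \<and> \<eta> < ?h n \<and> 0 < \<xi>' \<and> \<xi>' < ?h n \<and> 0 < \<eta>' \<and> \<eta>' < ?h n \<and>
      (hessian f (x + \<xi> *\<^sub>R v + \<eta> *\<^sub>R w) *v w) \<bullet> v = (hessian f (x + \<xi>' *\<^sub>R w + \<eta>' *\<^sub>R v) *v v) \<bullet> w" for n
    proof -
      have hn: "0 < ?h n" by simp
      obtain \<xi> \<eta> where 1: "0 < \<xi>" "\<xi> < ?h n" "0 < \<eta>" "\<eta> < ?h n"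
        "f (x + ?h n *\<^sub>R v + ?h n *\<^sub>R w) - f (x + ?h n *\<^sub>R v) - f (x + ?h n *\<^sub>R w) + f x =
        ?h n * (?h n * ((hessian f (x + \<xi> *\<^sub>R v + \<eta> *\<^sub>R w) *v w) \<bullet> v))"
        using second_difference[OF hn, of x v w] by blast
      obtain \<xi>' \<eta>' where 2: "0 < \<xi>'" "\<xi>' < ?h n" "0 < \<eta>'" "\<eta>' < ?h n"
        "f (x + ?h n *\<^sub>R w + ?h n *\<^sub>R v) - f (x + ?h n *\<^sub>R w) - f (x + ?h n *\<^sub>R v) + f x =
        ?h n * (?h n * ((hessian f (x + \<xi>' *\<^sub>R w + \<eta>' *\<^sub>R v) *v v) \<bullet> w))"
        using second_difference[OF hn, of x w v] by blast
      have "?h n * (?h n * ((hessian f (x + \<xi> *\<^sub>R v + \<eta> *\<^sub>R w) *v w) \<bullet> v)) =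
          ?h n * (?h n * ((hessian f (x + \<xi>' *\<^sub>R w + \<eta>' *\<^sub>R v) *v v) \<bullet> w))"
        unfolding 1(5)[symmetric] 2(5)[symmetric] by (simp add: add_ac)
      then have "(hessian f (x + \<xi> *\<^sub>R v + \<eta> *\<^sub>R w) *v w) \<bullet> v = (hessian f (x + \<xi>' *\<^sub>R w + \<eta>' *\<^sub>R v) *v v) \<bullet> w"
        using hn by (metis mult_cancel_left less_irrefl)
      with 1 2 show ?thesis by blast
    qed
    then obtain \<xi> \<eta> \<xi>' \<eta>' where b: "\<And>n. 0 < \<xi> n" "\<And>n. \<xi> n < ?h n" "\<And>n. 0 < \<eta> n" "\<And>n. \<eta> n < ?h n"
        "\<And>n. 0 < \<xi>' n" "\<And>n. \<xi>' n < ?h n" "\<And>n. 0 < \<eta>' n" "\<And>n. \<eta>' n < ?h n"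
      and eq: "\<And>n. (hessian f (x + \<xi> n *\<^sub>R v + \<eta> n *\<^sub>R w) *v w) \<bullet> v =
        (hessian f (x + \<xi>' n *\<^sub>R w + \<eta>' n *\<^sub>R v) *v v) \<bullet> w"
      by metis
    have to0: "g \<longlonglongrightarrow> 0" if "\<And>n. 0 < g n" "\<And>n. g n < ?h n" for g
      by (rule tendsto_sandwich[OF always_eventually always_eventually tendsto_const h])
         (blast intro: less_imp_le that)+
    have H: "(\<lambda>n. hessian f (y n)) \<longlonglongrightarrow> hessian f x" if "y \<longlonglongrightarrow> x" for y
      using cont that by (auto simp: continuous_on_eq_continuous_at intro: isCont_tendsto_compose)
    have lim: "(\<lambda>n. (A n *v w) \<bullet> v) \<longlonglongrightarrow> (B *v w) \<bullet> v" if "A \<longlonglongrightarrow> B" for A :: "nat \<Rightarrow> real^'n^'n" and B v w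
      using that unfolding matrix_vector_mult_def by (intro tendsto_intros)
    have "(\<lambda>n. x + \<xi> n *\<^sub>R v + \<eta> n *\<^sub>R w) \<longlonglongrightarrow> x + 0 *\<^sub>R v + 0 *\<^sub>R w"
      by (intro tendsto_intros to0 b)
    then have 1: "(\<lambda>n. (hessian f (x + \<xi> n *\<^sub>R v + \<eta> n *\<^sub>R w) *v w) \<bullet> v) \<longlonglongrightarrow> (hessian f x *v w) \<bullet> v"
      by (intro lim H) simp
    have "(\<lambda>n. x + \<xi>' n *\<^sub>R w + \<eta>' n *\<^sub>R v) \<longlonglongrightarrow> x + 0 *\<^sub>R w + 0 *\<^sub>R v"
      by (intro tendsto_intros to0 b)
    then have 2: "(\<lambda>n. (hessian f (x + \<xi>' n *\<^sub>R w + \<eta>' n *\<^sub>R v) *v v) \<bullet> w) \<longlonglongrightarrow> (hessian f x *v v) \<bullet> w"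
      by (intro lim H) simp
    show ?thesis using 1 2 LIMSEQ_unique unfolding eq by blast
  qed
  have "hessian f x $ i $ j = hessian f x $ j $ i" for i j
    using sym[of "axis j 1" "axis i 1"]
    by (simp add: matrix_vector_mul_component inner_axis matrix_vector_mult_basis column_def)
  then show ?thesis by (simp add: Sym_def transpose_def vec_eq_iff)
qed

end

lemma GDERIV_scale_compose:
  assumes "GDERIV f x :> g" "(\<theta> has_real_derivative d) (at (f x))"
  shows "GDERIV (\<lambda>x. c * \<theta> (f x)) x :> (c * d) *\<^sub>R g"
proof -
  have "GDERIV (\<lambda>x. \<theta> (f x)) x :> d *\<^sub>R g"
    using assms by (rule GDERIV_DERIV_compose)
  from GDERIV_mult[OF GDERIV_const[of c] this] show ?thesis by simp
qed

text \<open>In use \<theta> is already a first derivative, so d is a second one, and c is the value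
  of the time cut-off.\<close>

lemma has_derivative_scale_gradient:
  assumes f: "GDERIV f x :> g x" and g: "(g has_derivative (\<lambda>h. H *v h)) (at x)"
    and \<theta>: "(\<theta> has_real_derivative d) (at (f x))"
  shows "((\<lambda>x. (c * \<theta> (f x)) *\<^sub>R g x) has_derivative
    (\<lambda>h. ((c * \<theta> (f x)) *\<^sub>R H + (c * d) *\<^sub>R outer (g x)) *v h)) (at x)"
proof -
  have "((\<lambda>x. c * \<theta> (f x)) has_derivative (\<lambda>h. h \<bullet> ((c * d) *\<^sub>R g x))) (at x)"
    using GDERIV_scale_compose[OF f \<theta>] unfolding gderiv_def .
  from has_derivative_scaleR[OF this g] show ?thesis
    by (simp add: matrix_vector_mult_add_rdistrib scaleR_matrix_vector_assoc[symmetric] outer_mult inner_commute)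
qed

section \<open>Test functions\<close>

text \<open>\<open>C12b\<close> speaks of derivatives through \<open>deriv\<close>,
  \<open>THE\<close> and \<open>jacobian\<close>. Here explicit candidates are supplied, and they
  are identified with those operators along with the membership.\<close>

lemma C12bI:
  assumes cont: "continuous_on ({s..t} \<times> UNIV) (\<lambda>(r, x). \<phi> r x)"
    and d: "\<And>r x. r \<in> {s<..<t} \<Longrightarrow> ((\<lambda>r. \<phi> r x) has_real_derivative d r x) (at r)"
    and g: "\<And>r x. r \<in> {s<..<t} \<Longrightarrow> GDERIV (\<phi> r) x :> g r x"
    and H: "\<And>r x. r \<in> {s<..<t} \<Longrightarrow> (g r has_derivative (\<lambda>h. H r x *v h)) (at x)"
    and cd: "continuous_on ({s<..<t} \<times> UNIV) (\<lambda>(r, x). d r x)"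
    and cg: "continuous_on ({s<..<t} \<times> UNIV) (\<lambda>(r, x). g r x)"
    and cH: "continuous_on ({s<..<t} \<times> UNIV) (\<lambda>(r, x). H r x)"
    and bd: "\<And>r x. r \<in> {s<..<t} \<Longrightarrow> \<bar>d r x\<bar> \<le> C"
    and bH: "\<And>r x. r \<in> {s<..<t} \<Longrightarrow> norm (H r x) \<le> C"
  shows "C12b s t \<phi>" 
    and "\<And>r x. r \<in> {s<..<t} \<Longrightarrow> dt \<phi> r x = d r x"
    and "\<And>r x. r \<in> {s<..<t} \<Longrightarrow> gradient (\<phi> r) x = g r x"
    and "\<And>r x. r \<in> {s<..<t} \<Longrightarrow> hessian (\<phi> r) x = H r x"
proof -
  show dt: "dt \<phi> r x = d r x" if "r \<in> {s<..<t}" for r x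
    unfolding dt_def using DERIV_imp_deriv[OF d[OF that]] .
  show gr: "gradient (\<phi> r) x = g r x" if "r \<in> {s<..<t}" for r x
    using gradientI[OF g[OF that]] .
  have gr': "gradient (\<phi> r) = g r" if "r \<in> {s<..<t}" for r
    using gr[OF that] by (rule ext)
  show he: "hessian (\<phi> r) x = H r x" if "r \<in> {s<..<t}" for r x
    using H[OF that] by (intro hessianI) (simp add: gr'[OF that])
  have eq: "continuous_on ({s<..<t} \<times> UNIV) (\<lambda>(r, x). dt \<phi> r x)"
    "continuous_on ({s<..<t} \<times> UNIV) (\<lambda>(r, x). gradient (\<phi> r) x)"
    "continuous_on ({s<..<t} \<times> UNIV) (\<lambda>(r, x). hessian (\<phi> r) x)"
    by (rule continuous_on_eq[OF cd], force simp: dt, rule continuous_on_eq[OF cg], force simp: gr,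
        rule continuous_on_eq[OF cH], force simp: he)
  show "C12b s t \<phi>"
    unfolding C12b_def
  proof (intro conjI ballI allI eq cont)
    fix r x assume r: "r \<in> {s<..<t}"
    show "(\<lambda>r. \<phi> r x) differentiable at r"
      using d[OF r] by (auto simp: real_differentiable_def)
    show "\<phi> r differentiable at x"
      using g[OF r] by (auto simp: gderiv_def differentiable_def)
    show "gradient (\<phi> r) differentiable at x"
      using H[OF r] by (auto simp: gr'[OF r] differentiable_def)
  next
    show "bounded ((\<lambda>(r, x). dt \<phi> r x) ` ({s<..<t} \<times> UNIV))"
      unfolding bounded_iff using bd by (auto simp: dt intro!: exI[of _ C])
    show "bounded ((\<lambda>(r, x). hessian (\<phi> r) x) ` ({s<..<t} \<times> UNIV))"
      unfolding bounded_iff using bH by (auto simp: he intro!: exI[of _ C])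
  qed
qed

context
  fixes s t :: real and \<phi> :: "real \<Rightarrow> real^'n \<Rightarrow> real"
  assumes \<phi>: "C12b s t \<phi>"
begin

lemma C12b_cont: "continuous_on ({s..t} \<times> UNIV) (\<lambda>(r, x). \<phi> r x)"
  "continuous_on ({s<..<t} \<times> UNIV) (\<lambda>(r, x). dt \<phi> r x)"
  "continuous_on ({s<..<t} \<times> UNIV) (\<lambda>(r, x). gradient (\<phi> r) x)"
  "continuous_on ({s<..<t} \<times> UNIV) (\<lambda>(r, x). hessian (\<phi> r) x)"
  using \<phi> unfolding C12b_def by auto

lemma C12b_continuous_slice:
  assumes "r \<in> {s..t}"
  shows "continuous_on UNIV (\<phi> r)"
proof -
  have "continuous_on UNIV ((\<lambda>(r, x). \<phi> r x) \<circ> Pair r)"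
    using assms by (intro continuous_on_compose continuous_intros continuous_on_subset[OF C12b_cont(1)]) auto
  then show ?thesis by (simp add: o_def)
qed

lemma C12b_dt: "r \<in> {s<..<t} \<Longrightarrow> ((\<lambda>r. \<phi> r x) has_real_derivative dt \<phi> r x) (at r)"
  using \<phi> unfolding C12b_def dt_def by (simp add: DERIV_deriv_iff_real_differentiable)

lemma C12b_twice_diff: "r \<in> {s<..<t} \<Longrightarrow> twice_diff (\<phi> r)"
  using \<phi> unfolding C12b_def by unfold_locales auto

lemma C12b_gradient: "r \<in> {s<..<t} \<Longrightarrow> GDERIV (\<phi> r) x :> gradient (\<phi> r) x"
  using twice_diff.diff1[OF C12b_twice_diff] by (rule gderiv_gradient)

lemma C12b_hessian:
  "r \<in> {s<..<t} \<Longrightarrow> (gradient (\<phi> r) has_derivative (\<lambda>h. hessian (\<phi> r) x *v h)) (at x)"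
  using twice_diff.diff2[OF C12b_twice_diff] by (rule has_derivative_hessian)

lemma C12b_hessian_Sym:
  assumes r: "r \<in> {s<..<t}"
  shows "hessian (\<phi> r) x \<in> Sym"
proof (rule twice_diff.hessian_Sym[OF C12b_twice_diff[OF r]])
  have "continuous_on UNIV ((\<lambda>(r, x). hessian (\<phi> r) x) \<circ> Pair r)"
    using r by (intro continuous_on_compose continuous_intros continuous_on_subset[OF C12b_cont(4)]) auto
  then show "continuous_on UNIV (hessian (\<phi> r))" by (simp add: o_def)
qed

text \<open>One constant for both bounds, strictly positive because \<open>gradient_sq_le\<close>
  divides by it.\<close>

lemma C12b_bounds:
  obtains C where "0 < C" "\<And>r x. r \<in> {s<..<t} \<Longrightarrow> \<bar>dt \<phi> r x\<bar> \<le> C"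
    "\<And>r x. r \<in> {s<..<t} \<Longrightarrow> norm (hessian (\<phi> r) x) \<le> C"
proof -
  have "bounded ((\<lambda>(r, x). dt \<phi> r x) ` ({s<..<t} \<times> UNIV))"
    "bounded ((\<lambda>(r, x). hessian (\<phi> r) x) ` ({s<..<t} \<times> UNIV))"
    using \<phi> unfolding C12b_def by auto
  then obtain C1 C2 where C: "0 < C1" "\<forall>y\<in>(\<lambda>(r, x). dt \<phi> r x) ` ({s<..<t} \<times> UNIV). norm y \<le> C1"
    "\<forall>y\<in>(\<lambda>(r, x). hessian (\<phi> r) x) ` ({s<..<t} \<times> UNIV). norm y \<le> C2"
    unfolding bounded_pos by blast
  show thesis
    using C by (intro that[of "max C1 C2"]) (force simp: le_max_iff_disj)+
qed

text \<open>The time derivative is controlled on the open interval only; continuity up to the end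
  points carries the mean value theorem to the closed one.\<close>

lemma C12b_Lipschitz_time:
  assumes C: "\<And>r x. r \<in> {s<..<t} \<Longrightarrow> \<bar>dt \<phi> r x\<bar> \<le> C"
    and r: "r \<in> {s..t}" "r' \<in> {s..t}"
  shows "\<bar>\<phi> r x - \<phi> r' x\<bar> \<le> C * \<bar>r - r'\<bar>"
proof -
  have *: "\<bar>\<phi> v x - \<phi> u x\<bar> \<le> C * \<bar>v - u\<bar>" if "u < v" "s \<le> u" "v \<le> t" for u v
  proof -
    have "continuous_on {u..v} ((\<lambda>(r, x). \<phi> r x) \<circ> (\<lambda>r. (r, x)))"
      using that by (intro continuous_on_compose continuous_intros continuous_on_subset[OF C12b_cont(1)]) auto
    then have "continuous_on {u..v} (\<lambda>r. \<phi> r x)" by (simp add: o_def)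
    moreover have "(\<lambda>r. \<phi> r x) differentiable (at z)" if "u < z" "z < v" for z
      using C12b_dt[of z x] that \<open>s \<le> u\<close> \<open>v \<le> t\<close> unfolding real_differentiable_def by auto
    ultimately obtain l z where z: "u < z" "z < v"
        "((\<lambda>r. \<phi> r x) has_real_derivative l) (at z)" "\<phi> v x - \<phi> u x = (v - u) * l"
      using MVT[OF \<open>u < v\<close>] by blast
    then have zst: "z \<in> {s<..<t}" using that by auto
    have "l = dt \<phi> z x" using DERIV_unique[OF z(3) C12b_dt[OF zst]] .
    then show ?thesis using z(4) C[OF zst, of x] that(1) by (simp add: abs_mult mult.commute mult_left_mono)
  qed
  show ?thesis
    using *[of r r'] *[of r' r] r by (cases r r' rule: linorder_cases) (auto simp: abs_minus_commute)
qed

lemma C12b_subinterval: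
  assumes "s \<le> s'" "t' \<le> t"
  shows "C12b s' t' \<phi>"
proof -
  have sub: "{s'..t'} \<subseteq> {s..t}" "{s'<..<t'} \<subseteq> {s<..<t}" using assms by auto
  show ?thesis
    using \<phi> sub unfolding C12b_def
    by (intro conjI ballI allI)
       (blast intro: continuous_on_subset bounded_subset[OF _ image_mono])+
qed

end

text \<open>Nothing is known about second derivatives at the end times. Growth is therefore
  established at the midpoint and transported in time by the Lipschitz bound.\<close>

lemma C12b_quadratic_growth:
  fixes \<phi> :: "real \<Rightarrow> real^'n \<Rightarrow> real"
  assumes \<phi>: "C12b s t \<phi>" and "s < t"
  obtains M where "0 \<le> M" "\<And>r x. r \<in> {s..t} \<Longrightarrow> \<bar>\<phi> r x\<bar> \<le> M * (1 + (norm x)\<^sup>2)"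
proof -
  obtain C where C: "0 < C" "\<And>r x. r \<in> {s<..<t} \<Longrightarrow> \<bar>dt \<phi> r x\<bar> \<le> C"
    "\<And>r x. r \<in> {s<..<t} \<Longrightarrow> norm (hessian (\<phi> r) x) \<le> C"
    using C12b_bounds[OF \<phi>] by metis
  define m where "m = (s + t) / 2"
  have m: "m \<in> {s<..<t}" using \<open>s < t\<close> by (simp add: m_def)
  obtain M where M: "0 \<le> M" "\<And>x. \<bar>\<phi> m x\<bar> \<le> M * (1 + (norm x)\<^sup>2)"
    using twice_diff.quadratic_growth[OF C12b_twice_diff[OF \<phi> m] C(3)[OF m]] by metis
  show thesis
  proof (rule that[of "M + C * (t - s)"])
    show "0 \<le> M + C * (t - s)" using M C \<open>s < t\<close> by simp
    fix r x assume r: "r \<in> {s..t}"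
    have "\<bar>\<phi> r x - \<phi> m x\<bar> \<le> C * \<bar>r - m\<bar>"
      using C12b_Lipschitz_time[OF \<phi> C(2) r] m by auto
    also have "\<dots> \<le> C * (t - s)"
      using r m C(1) by (intro mult_left_mono) auto
    also have "\<dots> \<le> C * (t - s) * (1 + (norm x)\<^sup>2)"
      using C(1) \<open>s < t\<close> by simp
    finally show "\<bar>\<phi> r x\<bar> \<le> (M + C * (t - s)) * (1 + (norm x)\<^sup>2)"
      using M(2)[of x] by (simp add: algebra_simps)
  qed
qed

lemma C12b_add:
  fixes \<phi> \<psi> :: "real \<Rightarrow> real^'n \<Rightarrow> real"
  assumes \<phi>: "C12b s t \<phi>" and \<psi>: "C12b s t \<psi>"
  shows "C12b s t (\<lambda>r x. \<phi> r x + \<psi> r x)"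
    and "\<And>r x. r \<in> {s<..<t} \<Longrightarrow> dt (\<lambda>r x. \<phi> r x + \<psi> r x) r x = dt \<phi> r x + dt \<psi> r x"
    and "\<And>r x. r \<in> {s<..<t} \<Longrightarrow> hessian (\<lambda>x. \<phi> r x + \<psi> r x) x = hessian (\<phi> r) x + hessian (\<psi> r) x"
proof -
  obtain C where C: "0 < C" "\<And>r x. r \<in> {s<..<t} \<Longrightarrow> \<bar>dt \<phi> r x\<bar> \<le> C"
    "\<And>r x. r \<in> {s<..<t} \<Longrightarrow> norm (hessian (\<phi> r) x) \<le> C"
    using C12b_bounds[OF \<phi>] by metis
  obtain D where D: "0 < D" "\<And>r x. r \<in> {s<..<t} \<Longrightarrow> \<bar>dt \<psi> r x\<bar> \<le> D"
    "\<And>r x. r \<in> {s<..<t} \<Longrightarrow> norm (hessian (\<psi> r) x) \<le> D"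
    using C12b_bounds[OF \<psi>] by metis
  note rules = C12bI[where \<phi> = "\<lambda>r x. \<phi> r x + \<psi> r x" and d = "\<lambda>r x. dt \<phi> r x + dt \<psi> r x"
      and g = "\<lambda>r x. gradient (\<phi> r) x + gradient (\<psi> r) x"
      and H = "\<lambda>r x. hessian (\<phi> r) x + hessian (\<psi> r) x" and C = "C + D" and s = s and t = t]
  have 1: "continuous_on ({s..t} \<times> UNIV) (\<lambda>(r, x). \<phi> r x + \<psi> r x)"
    "continuous_on ({s<..<t} \<times> UNIV) (\<lambda>(r, x). dt \<phi> r x + dt \<psi> r x)"
    "continuous_on ({s<..<t} \<times> UNIV) (\<lambda>(r, x). gradient (\<phi> r) x + gradient (\<psi> r) x)"
    "continuous_on ({s<..<t} \<times> UNIV) (\<lambda>(r, x). hessian (\<phi> r) x + hessian (\<psi> r) x)"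
    using C12b_cont[OF \<phi>] C12b_cont[OF \<psi>] unfolding case_prod_unfold by (auto intro: continuous_on_add)
  have 2: "((\<lambda>r. \<phi> r x + \<psi> r x) has_real_derivative dt \<phi> r x + dt \<psi> r x) (at r)"
    "GDERIV (\<lambda>x. \<phi> r x + \<psi> r x) x :> gradient (\<phi> r) x + gradient (\<psi> r) x"
    "((\<lambda>x. gradient (\<phi> r) x + gradient (\<psi> r) x) has_derivative
      (\<lambda>h. (hessian (\<phi> r) x + hessian (\<psi> r) x) *v h)) (at x)"
    "\<bar>dt \<phi> r x + dt \<psi> r x\<bar> \<le> C + D" "norm (hessian (\<phi> r) x + hessian (\<psi> r) x) \<le> C + D"
    if "r \<in> {s<..<t}" for r x
    using C(2,3)[OF that, of x] D(2,3)[OF that, of x] C12b_gradient[OF \<phi> that] C12b_gradient[OF \<psi> that]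
      C12b_dt[OF \<phi> that] C12b_dt[OF \<psi> that] C12b_hessian[OF \<phi> that] C12b_hessian[OF \<psi> that]
    by (auto intro!: DERIV_add GDERIV_add has_derivative_add simp: matrix_vector_mult_add_rdistrib
        intro: norm_triangle_le)
  show "C12b s t (\<lambda>r x. \<phi> r x + \<psi> r x)"
    by (rule rules(1)) (use 1 2 in auto)
  show "dt (\<lambda>r x. \<phi> r x + \<psi> r x) r x = dt \<phi> r x + dt \<psi> r x" if "r \<in> {s<..<t}" for r x
    by (rule rules(2)) (use 1 2 that in auto)
  show "hessian (\<lambda>x. \<phi> r x + \<psi> r x) x = hessian (\<phi> r) x + hessian (\<psi> r) x" if "r \<in> {s<..<t}" for r x
    by (rule rules(4)) (use 1 2 that in auto)
qed

text \<open>Its Hessian is the constant 2 M times the identity, so this function can dominate any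
  test function while remaining one.\<close>

lemma C12b_square_norm:
  fixes M :: real
  shows "C12b s t (\<lambda>r x :: real^'n. M * (1 + (norm x)\<^sup>2))"
proof -
  define q :: "real^'n \<Rightarrow> real" where "q x = M * (1 + x \<bullet> x)" for x
  have "GDERIV q x :> (2 * M) *\<^sub>R x" for x
    unfolding gderiv_def q_def
    by (auto intro!: derivative_eq_intros simp: inner_commute)
  moreover have "((\<lambda>x. (2 * M) *\<^sub>R x) has_derivative (\<lambda>h. ((2 * M) *\<^sub>R mat 1) *v h)) (at x)" for x :: "real^'n"
    by (auto intro!: derivative_eq_intros simp: scaleR_matrix_vector_assoc[symmetric])
  ultimately have "C12b s t (\<lambda>r. q)"
    by (intro C12bI(1)[where d = "\<lambda>r x. 0" and g = "\<lambda>r x. (2 * M) *\<^sub>R x" and H = "\<lambda>r x. (2 * M) *\<^sub>R mat 1"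
          and C = "norm ((2 * M) *\<^sub>R mat 1 :: real^'n^'n)"])
       (auto simp: case_prod_unfold q_def intro!: continuous_intros)
  moreover have "q = (\<lambda>x. M * (1 + (norm x)\<^sup>2))"
    by (simp add: q_def fun_eq_iff power2_norm_eq_inner)
  ultimately show ?thesis by simp
qed

section \<open>Curves of measures as kernels\<close>

text \<open>Fubini for a kernel: the positive and negative parts P and Q are handled by the
  non-negative version and are finite almost everywhere. On the exceptional null set the inner
  integral takes a default value, which affects neither conclusion.\<close>

lemma integrable_bind_AE:
  fixes f :: "'b \<Rightarrow> real"
  assumes N: "N \<in> measurable M (subprob_algebra B)" and M: "space M \<noteq> {}" and f: "integrable (M \<bind> N) f"
  shows "AE x in M. integrable (N x) f"
    and "integrable M (\<lambda>x. \<integral>y. f y \<partial>N x)"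
    and "(\<integral>y. f y \<partial>(M \<bind> N)) = (\<integral>x. \<integral>y. f y \<partial>N x \<partial>M)"
proof -
  have setsN: "sets (N x) = sets B" if "x \<in> space M" for x
    using measurable_space[OF N that] by (simp add: space_subprob_algebra)
  have fB: "f \<in> borel_measurable B"
    using borel_measurable_integrable[OF f] sets_bind[OF setsN M]
    by (simp cong: measurable_cong_sets)
  define P Q where "P x = (\<integral>\<^sup>+y. ennreal (f y) \<partial>N x)" and "Q x = (\<integral>\<^sup>+y. ennreal (- f y) \<partial>N x)" for x
  have PQ: "P \<in> borel_measurable M" "Q \<in> borel_measurable M"
    unfolding P_def Q_def using fB
    by (auto intro!: measurable_compose[OF N nn_integral_measurable_subprob_algebra])
  have nnP: "(\<integral>\<^sup>+y. ennreal (f y) \<partial>(M \<bind> N)) = (\<integral>\<^sup>+x. P x \<partial>M)"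
    and nnQ: "(\<integral>\<^sup>+y. ennreal (- f y) \<partial>(M \<bind> N)) = (\<integral>\<^sup>+x. Q x \<partial>M)"
    unfolding P_def Q_def using fB by (auto intro!: nn_integral_bind[OF _ N])
  have fin: "(\<integral>\<^sup>+x. P x \<partial>M) < \<infinity>" "(\<integral>\<^sup>+x. Q x \<partial>M) < \<infinity>"
    using f unfolding real_integrable_def nnP nnQ by (auto simp: top.not_eq_extremum)
  have AEP: "AE x in M. P x \<noteq> \<infinity>" "AE x in M. Q x \<noteq> \<infinity>"
    using nn_integral_PInf_AE[OF PQ(1)] nn_integral_PInf_AE[OF PQ(2)] fin by auto
  have int: "integrable (N x) f" if "x \<in> space M" "P x \<noteq> \<infinity>" "Q x \<noteq> \<infinity>" for x
    using that fB measurable_cong_sets[OF setsN[OF that(1)] refl] unfolding real_integrable_def P_def Q_def by auto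
  show AEint: "AE x in M. integrable (N x) f"
    using AEP AE_space by eventually_elim (rule int)
  have eq: "AE x in M. (\<integral>y. f y \<partial>N x) = enn2real (P x) - enn2real (Q x)"
    using AEint by eventually_elim (simp add: real_lebesgue_integral_def P_def Q_def)
  have nnr: "(\<integral>\<^sup>+x. ennreal (enn2real (P x)) \<partial>M) = (\<integral>\<^sup>+x. P x \<partial>M)"
    "(\<integral>\<^sup>+x. ennreal (enn2real (Q x)) \<partial>M) = (\<integral>\<^sup>+x. Q x \<partial>M)"
    using AEP(1) by (intro nn_integral_cong_AE, elim eventually_mono, simp add: top.not_eq_extremum)
      (use AEP(2) in \<open>intro nn_integral_cong_AE, elim eventually_mono, simp add: top.not_eq_extremum\<close>)
  have iP: "integrable M (\<lambda>x. enn2real (P x))" "integrable M (\<lambda>x. enn2real (Q x))"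
    using PQ fin nnr by (auto intro!: integrableI_nonneg)
  have meas: "(\<lambda>x. \<integral>y. f y \<partial>N x) \<in> borel_measurable M"
    using measurable_compose[OF N integral_measurable_subprob_algebra[OF fB]] .
  show "integrable M (\<lambda>x. \<integral>y. f y \<partial>N x)"
    by (rule integrable_cong_AE_imp[OF Bochner_Integration.integrable_diff[OF iP] meas]) (use eq in auto)
  have "(\<integral>x. \<integral>y. f y \<partial>N x \<partial>M) = (\<integral>x. enn2real (P x) - enn2real (Q x) \<partial>M)"
    using eq meas PQ by (intro integral_cong_AE) auto
  also have "\<dots> = enn2real (\<integral>\<^sup>+x. P x \<partial>M) - enn2real (\<integral>\<^sup>+x. Q x \<partial>M)"
    using iP nnr by (simp add: integral_eq_nn_integral)
  also have "\<dots> = (\<integral>y. f y \<partial>(M \<bind> N))"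
    using f by (simp add: real_lebesgue_integral_def nnP nnQ)
  finally show "(\<integral>y. f y \<partial>(M \<bind> N)) = (\<integral>x. \<integral>y. f y \<partial>N x \<partial>M)" ..
qed

locale P2_curve =
  fixes \<rho> :: "real \<Rightarrow> (real^'n) measure"
  assumes cont: "continuous_map (top_of_set {0..1}) P2_topology \<rho>"
begin

text \<open>Extending the curve by its end values makes it a kernel on the whole line.\<close>

definition \<kappa> :: "real \<Rightarrow> (real^'n) measure" where
  "\<kappa> r = \<rho> (max 0 (min 1 r))"

lemma \<kappa>_eq: "r \<in> {0..1} \<Longrightarrow> \<kappa> r = \<rho> r"
  by (simp add: \<kappa>_def)

lemma \<rho>_P2: "r \<in> {0..1} \<Longrightarrow> \<rho> r \<in> P2"
  using cont unfolding continuous_map_P2_topology_iff by auto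

lemma \<kappa>_P2: "\<kappa> r \<in> P2"
  unfolding \<kappa>_def by (rule \<rho>_P2) auto

lemma prob_\<kappa>: "prob_space (\<kappa> r)" and sets_\<kappa> [simp, measurable_cong]: "sets (\<kappa> r) = sets borel"
  using \<kappa>_P2[of r] by (auto simp: P2_def)

lemma space_\<kappa> [simp]: "space (\<kappa> r) = UNIV"
  using sets_eq_imp_space_eq[OF sets_\<kappa>] by simp

lemma continuous_on_integral_\<kappa>:
  fixes f :: "real^'n \<Rightarrow> real"
  assumes "continuous_on UNIV f" "bounded (range f)"
  shows "continuous_on UNIV (\<lambda>r. LINT x|\<kappa> r. f x)"
proof -
  have "continuous_on {0..1} (\<lambda>r. LINT x|\<rho> r. f x)"
    using cont assms unfolding continuous_map_P2_topology_iff by auto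
  then have "continuous_on UNIV ((\<lambda>r. LINT x|\<rho> r. f x) \<circ> (\<lambda>r. max 0 (min 1 r)))"
    by (intro continuous_on_compose continuous_intros) (auto elim: continuous_on_subset)
  then show ?thesis by (simp add: o_def \<kappa>_def)
qed

text \<open>Open sets form an intersection-stable generator, and the indicator of an open set is the
  pointwise limit of the bounded continuous functions min(1, n dist(x, complement)), whose integrals
  are continuous in r.\<close>

lemma measurable_\<kappa>: "\<kappa> \<in> measurable borel (subprob_algebra borel)"
proof (rule measurable_subprob_algebra_generated[where G = "{S. open S}" and \<Omega> = UNIV])
  show "sets borel = sigma_sets UNIV {S :: (real^'n) set. open S}"
    by (simp add: borel_def)
  show "Int_stable {S :: (real^'n) set. open S}"
    by (auto simp: Int_stable_def)
  show "subprob_space (\<kappa> r)" for r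
    using prob_\<kappa> by (rule prob_space_imp_subprob_space)
  have one: "emeasure (\<kappa> r) UNIV = 1" for r
    using prob_space.emeasure_space_1[OF prob_\<kappa>] by simp
  then show "(\<lambda>r. emeasure (\<kappa> r) UNIV) \<in> borel_measurable borel" by simp
  fix S :: "(real^'n) set" assume "S \<in> {S. open S}"
  then have S: "open S" by simp
  show "(\<lambda>r. emeasure (\<kappa> r) S) \<in> borel_measurable borel"
  \<comment> \<open>The whole space is separate: its complement is empty, where
    \<open>infdist\<close> is 0 by convention.\<close>
  proof (cases "S = UNIV")
    case True
    with one show ?thesis by simp
  next
    case False
    define g where "g n x = min 1 (real n * infdist x (- S))" for n x
    have g: "continuous_on UNIV (g n)" "\<And>x. 0 \<le> g n x" "\<And>x. g n x \<le> 1" for n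
      unfolding g_def by (auto intro!: continuous_intros simp: infdist_nonneg)
    have lim: "(\<lambda>n. g n x) \<longlonglongrightarrow> indicator S x" for x
    proof (cases "x \<in> S")
      case True
      then have pos: "0 < infdist x (- S)"
        using S False by (intro infdist_pos_not_in_closed) auto
      obtain n0 where n0: "1 < real n0 * infdist x (- S)"
        using reals_Archimedean3[OF pos] by blast
      have "g n x = 1" if "n0 \<le> n" for n
      proof -
        have "real n0 * infdist x (- S) \<le> real n * infdist x (- S)"
          using that pos by (intro mult_right_mono) auto
        with n0 show ?thesis by (simp add: g_def)
      qed
      then have "eventually (\<lambda>n. g n x = 1) sequentially"
        by (auto simp: eventually_sequentially)
      with True show ?thesis by (simp add: tendsto_eventually)
    next
      case False
      then show ?thesis by (simp add: g_def)
    qed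
    have "(\<lambda>n. LINT x|\<kappa> r. g n x) \<longlonglongrightarrow> (LINT x|\<kappa> r. indicator S x)" for r
    proof (rule integral_dominated_convergence[where w = "\<lambda>_. 1"])
      interpret prob_space "\<kappa> r" by (rule prob_\<kappa>)
      show "integrable (\<kappa> r) (\<lambda>_. 1 :: real)" by simp
      show "g n \<in> borel_measurable (\<kappa> r)" for n
        using borel_measurable_continuous_onI[OF g(1)] by simp
      show "(indicator S :: _ \<Rightarrow> real) \<in> borel_measurable (\<kappa> r)"
        using S by (simp cong: measurable_cong_sets)
    qed (use g(2,3) lim in auto)
    moreover have "(\<lambda>r. LINT x|\<kappa> r. g n x) \<in> borel_measurable borel" for n
    proof (intro borel_measurable_continuous_onI continuous_on_integral_\<kappa> g)
      show "bounded (range (g n))"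
        using g(2,3)[of n] by (auto intro!: boundedI[of _ 1])
    qed
    ultimately have "(\<lambda>r. LINT x|\<kappa> r. indicator S x :: real) \<in> borel_measurable borel"
      by (rule borel_measurable_LIMSEQ_real)
    then have "(\<lambda>r. measure (\<kappa> r) S) \<in> borel_measurable borel" by simp
    moreover have "emeasure (\<kappa> r) S = ennreal (measure (\<kappa> r) S)" for r
      using finite_measure.emeasure_eq_measure[OF prob_space.finite_measure[OF prob_\<kappa>]] by auto
    ultimately show ?thesis by simp
  qed
qed auto

section \<open>The measure on space-time\<close>

definition slice :: "real \<Rightarrow> (real \<times> (real^'n)) measure" where
  "slice r = distr (\<kappa> r) borel (Pair r)"

lemma measurable_slice: "slice \<in> measurable (restrict_space lborel A) (subprob_algebra borel)"
proof -
  have "slice \<in> measurable borel (subprob_algebra borel)"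
    unfolding slice_def
    by (rule measurable_distr2[OF _ measurable_\<kappa>]) (simp add: borel_prod)
  then show ?thesis by (simp add: measurable_restrict_space1)
qed

lemma Pair_measurable: "Pair r \<in> borel_measurable (\<kappa> s)"
  by (simp cong: measurable_cong_sets) (intro borel_measurable_continuous_onI continuous_intros)

text \<open>The measure with density d\<open>\<rho> r\<close>(x) dr on (0,1) x R^d. As
  \<open>\<rho> r\<close> varies with r it is no product, so it is built by binding Lebesgue measure
  to the kernel of the measures \<open>\<kappa> r\<close> placed at time r.\<close>

definition spacetime :: "(real \<times> (real^'n)) measure" where
  "spacetime = restrict_space lborel {0<..<1} \<bind> slice"

lemma sets_spacetime [simp, measurable_cong]: "sets spacetime = sets borel"
  unfolding spacetime_def by (rule sets_bind) (auto simp: slice_def space_restrict_space)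

lemma nn_integral_spacetime:
  assumes f: "f \<in> borel_measurable borel"
  shows "(\<integral>\<^sup>+z. f z \<partial>spacetime) = (\<integral>\<^sup>+r\<in>{0<..<1}. (\<integral>\<^sup>+x. f (r, x) \<partial>\<rho> r) \<partial>lborel)"
proof -
  have "(\<integral>\<^sup>+z. f z \<partial>spacetime) = (\<integral>\<^sup>+r. (\<integral>\<^sup>+z. f z \<partial>slice r) \<partial>restrict_space lborel {0<..<1})"
    unfolding spacetime_def by (rule nn_integral_bind[OF f measurable_slice])
  also have "\<dots> = (\<integral>\<^sup>+r\<in>{0<..<1}. (\<integral>\<^sup>+z. f z \<partial>slice r) \<partial>lborel)"
    by (subst nn_integral_restrict_space) auto
  also have "\<dots> = (\<integral>\<^sup>+r\<in>{0<..<1}. (\<integral>\<^sup>+x. f (r, x) \<partial>\<rho> r) \<partial>lborel)"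
    using f by (intro nn_integral_cong) (auto simp: slice_def nn_integral_distr Pair_measurable \<kappa>_eq indicator_def)
  finally show ?thesis .
qed

lemma finite_spacetime: "finite_measure spacetime"
proof
  have "emeasure spacetime (space spacetime) = (\<integral>\<^sup>+z. 1 \<partial>spacetime)" by simp
  also have "\<dots> = (\<integral>\<^sup>+r\<in>{0<..<1}. (1::ennreal) \<partial>(lborel :: real measure))"
    unfolding nn_integral_spacetime[OF borel_measurable_const]
  proof (intro nn_integral_cong)
    fix r :: real
    show "(\<integral>\<^sup>+x. 1 \<partial>\<rho> r) * indicator {0<..<1} r = 1 * indicator {0<..<1} r"
      using prob_space.emeasure_space_1[OF prob_\<kappa>[of r]] \<kappa>_eq[of r]
      by (auto simp: indicator_def simp del: space_\<kappa>)
  qed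
  also have "\<dots> = 1" by simp
  finally show "emeasure spacetime (space spacetime) \<noteq> \<infinity>" by simp
qed

lemma integral_spacetime:
  fixes f :: "real \<times> (real^'n) \<Rightarrow> real"
  assumes f: "integrable spacetime f"
  shows "(LINT z|spacetime. f z) = (LINT r:{0<..<1}|lborel. LINT x|\<rho> r. f (r, x))"
proof -
  have fb: "f \<in> borel_measurable borel" using borel_measurable_integrable[OF f] by simp
  have "(LINT z|spacetime. f z) = (LINT r|restrict_space lborel {0<..<1}. LINT z|slice r. f z)"
    using f unfolding spacetime_def
    by (intro integrable_bind_AE(3)[OF measurable_slice]) (auto simp: space_restrict_space)
  also have "\<dots> = (LINT r:{0<..<1}|lborel. LINT z|slice r. f z)"
    by (subst integral_restrict_space) (auto simp: set_lebesgue_integral_def)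
  also have "\<dots> = (LINT r:{0<..<1}|lborel. LINT x|\<rho> r. f (r, x))"
  proof (intro set_lebesgue_integral_cong allI impI)
    fix r :: real assume r: "r \<in> {0<..<1}"
    show "(LINT z|slice r. f z) = (LINT x|\<rho> r. f (r, x))"
      unfolding slice_def integral_distr[OF Pair_measurable fb] using r by (simp add: \<kappa>_eq)
  qed simp
  finally show ?thesis .
qed

lemma integral_spacetime_subinterval:
  fixes f :: "real \<times> (real^'n) \<Rightarrow> real"
  assumes "0 \<le> s" "t \<le> 1" and f: "integrable spacetime (\<lambda>z. indicator ({s<..<t} \<times> UNIV) z * f z)"
  shows "(LINT z|spacetime. indicator ({s<..<t} \<times> UNIV) z * f z) =
    (LINT r:{s<..<t}|lborel. LINT x|\<rho> r. f (r, x))"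
  unfolding integral_spacetime[OF f] set_lebesgue_integral_def
proof (rule Bochner_Integration.integral_cong[OF refl])
  fix r :: real
  show "indicator {0<..<1} r *\<^sub>R (LINT x|\<rho> r. indicator ({s<..<t} \<times> UNIV) (r, x) * f (r, x)) =
      indicator {s<..<t} r *\<^sub>R (LINT x|\<rho> r. f (r, x))"
    using assms(1,2) by (auto simp: indicator_def)
qed

end

section \<open>Cut-offs\<close>

text \<open>The triangle over [0,1] with peak 2 at 1/2, hence of mass 1; the hinges produce the
  slopes 4, -4 and 0.\<close>

definition hat :: "real \<Rightarrow> real" where
  "hat z = 4 * max 0 z - 8 * max 0 (z - 1/2) + 4 * max 0 (z - 1)"

text \<open>The primitive of \<open>hat\<close>, a step from 0 to 1. A quadratic spline is smooth
  enough, since test functions have one continuous time derivative.\<close>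

definition ramp :: "real \<Rightarrow> real" where
  "ramp z = 2 * (max 0 z)\<^sup>2 - 4 * (max 0 (z - 1/2))\<^sup>2 + 2 * (max 0 (z - 1))\<^sup>2"

lemma DERIV_max_square: "((\<lambda>z::real. (max 0 z)\<^sup>2) has_real_derivative 2 * max 0 z) (at z)"
proof (cases z "0::real" rule: linorder_cases)
  case less
  have "((\<lambda>z::real. 0) has_real_derivative 0) (at z)" by simp
  then have "((\<lambda>z::real. (max 0 z)\<^sup>2) has_real_derivative 0) (at z)"
    by (rule has_field_derivative_transform_within_open[where S = "{..<0}"]) (use less in auto)
  with less show ?thesis by simp
next
  case greater
  have "((\<lambda>z::real. z\<^sup>2) has_real_derivative 2 * z) (at z)"
    by (auto intro!: derivative_eq_intros)
  then have "((\<lambda>z::real. (max 0 z)\<^sup>2) has_real_derivative 2 * z) (at z)"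
    by (rule has_field_derivative_transform_within_open[where S = "{0<..}"]) (use greater in auto)
  with greater show ?thesis by simp
next
  case equal
  have "((\<lambda>h::real. (max 0 h)\<^sup>2 / h) \<longlongrightarrow> 0) (at 0)"
  proof (rule Lim_null_comparison)
    show "eventually (\<lambda>h::real. norm ((max 0 h)\<^sup>2 / h) \<le> \<bar>h\<bar>) (at 0)"
      by (intro always_eventually) (auto simp: max_def power2_eq_square)
    show "((\<lambda>h::real. \<bar>h\<bar>) \<longlongrightarrow> 0) (at 0)" by real_asymp
  qed
  with equal show ?thesis by (simp add: DERIV_def)
qed

lemma DERIV_ramp: "(ramp has_real_derivative hat z) (at z)"
proof -
  have shift: "((\<lambda>z. (max 0 (z - c))\<^sup>2) has_real_derivative 2 * max 0 (z - c)) (at z)" for c :: real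
  proof -
    have "((\<lambda>z. z - c) has_real_derivative 1) (at z)" by (auto intro!: derivative_eq_intros)
    from DERIV_chain2[where f = "\<lambda>z. (max 0 z)\<^sup>2" and g = "\<lambda>z. z - c", OF DERIV_max_square this]
    show ?thesis by simp
  qed
  have "(ramp has_real_derivative
      2 * (2 * max 0 z) - 4 * (2 * max 0 (z - 1/2)) + 2 * (2 * max 0 (z - 1))) (at z)"
    unfolding ramp_def[abs_def] by (intro DERIV_add DERIV_diff DERIV_cmult shift DERIV_max_square)
  then show ?thesis by (simp add: hat_def)
qed

lemma ramp_eq_0: "z \<le> 0 \<Longrightarrow> ramp z = 0"
  by (simp add: ramp_def)

lemma ramp_eq_1: "1 \<le> z \<Longrightarrow> ramp z = 1"
  by (simp add: ramp_def power2_eq_square algebra_simps)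

lemma hat_eq_0: "z \<le> 0 \<or> 1 \<le> z \<Longrightarrow> hat z = 0"
  by (auto simp: hat_def)

lemma hat_bounds: "0 \<le> hat z" "hat z \<le> 2"
  by (auto simp: hat_def max_def)

lemma ramp_bounds: "0 \<le> ramp z" "ramp z \<le> 1"
proof -
  have mono: "ramp x \<le> ramp y" if "x \<le> y" for x y
    using that by (rule DERIV_nonneg_imp_nondecreasing) (use DERIV_ramp hat_bounds in blast)
  show "0 \<le> ramp z" using mono[of "min z 0" z] by (simp add: ramp_eq_0)
  show "ramp z \<le> 1" using mono[of z "max z 1"] by (simp add: ramp_eq_1)
qed

lemma continuous_on_hat [continuous_intros]: "continuous_on S f \<Longrightarrow> continuous_on S (\<lambda>x. hat (f x))"
  unfolding hat_def by (intro continuous_intros)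

lemma hat_measurable [measurable]: "hat \<in> borel_measurable borel"
  by (intro borel_measurable_continuous_onI continuous_intros)

lemma integral_hat: "integrable lborel hat" "(LINT z|lborel. hat z) = 1"
proof -
  have eq: "(\<lambda>z. hat z * indicator {0..1} z) = hat"
  proof
    fix z show "hat z * indicator {0..1} z = hat z"
      using hat_eq_0[of z] by (cases "z \<in> {0..1}") auto
  qed
  have "has_bochner_integral lborel (\<lambda>z. hat z * indicator {0..1} z) (ramp 1 - ramp 0)"
    by (rule has_bochner_integral_FTC_Icc_real)
       (use DERIV_ramp continuous_on_hat[of UNIV "\<lambda>x. x"] in \<open>auto simp: continuous_on_eq_continuous_at\<close>)
  then show "integrable lborel hat" "(LINT z|lborel. hat z) = 1"
    unfolding eq by (auto simp: has_bochner_integral_iff ramp_eq_0 ramp_eq_1)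
qed

text \<open>The bump N hat(N (r - u) - j) has mass 1 and lives on u + [j, j+1]/N. The shift j keeps
  it on one side of u, so only one-sided values of G enter the limit. The proof substitutes r = u +
  (j + z)/N.\<close>

lemma hat_approximate_identity:
  fixes G :: "real \<Rightarrow> real" and N :: "nat \<Rightarrow> real"
  assumes G: "G \<in> borel_measurable borel" "\<And>r. \<bar>G r\<bar> \<le> B"
    and N: "\<And>n. 0 < N n"
    and lim: "\<And>z. 0 < z \<Longrightarrow> z < 1 \<Longrightarrow> (\<lambda>n. G (u + (j + z) / N n)) \<longlonglongrightarrow> l"
  shows "(\<lambda>n. LINT r|lborel. (N n * hat (N n * (r - u) - j)) * G r) \<longlonglongrightarrow> l"
proof -
  have "(LINT r|lborel. (N n * hat (N n * (r - u) - j)) * G r) = (LINT z|lborel. hat z * G (u + (j + z) / N n))" for n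
  proof -
    have "(LINT r|lborel. (N n * hat (N n * (r - u) - j)) * G r) =
      \<bar>1 / N n\<bar> *\<^sub>R (LINT z|lborel. (N n * hat (N n * ((u + j / N n) + (1 / N n) * z - u) - j)) * G ((u + j / N n) + (1 / N n) * z))"
      using N[of n] by (intro lborel_integral_real_affine) auto
    also have "\<dots> = (LINT z|lborel. (1 / N n) * (N n * hat (N n * ((u + j / N n) + (1 / N n) * z - u) - j) * G ((u + j / N n) + (1 / N n) * z)))"
      using N[of n] by (simp only: Bochner_Integration.integral_mult_right_zero real_scaleR_def abs_of_pos zero_less_divide_1_iff)
    also have "\<dots> = (LINT z|lborel. hat z * G (u + (j + z) / N n))"
      using N[of n] by (intro Bochner_Integration.integral_cong) (auto simp: field_simps)
    finally show ?thesis .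
  qed
  moreover have "(\<lambda>n. LINT z|lborel. hat z * G (u + (j + z) / N n)) \<longlonglongrightarrow> (LINT z|lborel. hat z * l)"
  proof (rule integral_dominated_convergence[where w = "\<lambda>z. hat z * B"])
    show "integrable lborel (\<lambda>z. hat z * B)" using integral_hat by simp
    have "(\<lambda>n. hat z * G (u + (j + z) / N n)) \<longlonglongrightarrow> hat z * l" for z
    proof (cases "0 < z \<and> z < 1")
      case True
      with lim[of z] show ?thesis by (intro tendsto_intros) auto
    next
      case False
      with hat_eq_0[of z] show ?thesis by auto
    qed
    then show "AE z in lborel. (\<lambda>n. hat z * G (u + (j + z) / N n)) \<longlonglongrightarrow> hat z * l" by simp
    show "AE z in lborel. norm (hat z * G (u + (j + z) / N n)) \<le> hat z * B" for n
      using G(2) hat_bounds by (auto simp: abs_mult intro!: mult_left_mono)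
  qed (use G(1) in measurable)
  ultimately show ?thesis using integral_hat by simp
qed

section \<open>Saturation of a non-negative function\<close>

definition sat :: "real \<Rightarrow> real \<Rightarrow> real" where "sat e z = z / (1 + e * z)"
definition sat1 :: "real \<Rightarrow> real \<Rightarrow> real" where "sat1 e z = 1 / (1 + e * z)\<^sup>2"
text \<open>\<open>sat1\<close> and \<open>sat2\<close> are the first and second derivatives of
  \<open>sat e\<close> in z.\<close>

definition sat2 :: "real \<Rightarrow> real \<Rightarrow> real" where "sat2 e z = - 2 * e / (1 + e * z) ^ 3"

context
  fixes e z :: real
  assumes e: "0 < e" and z: "0 \<le> z"
begin

lemma sat_pos: "1 \<le> 1 + e * z"
  using e z by simp

lemma DERIV_sat: "(sat e has_real_derivative sat1 e z) (at z)"
  unfolding sat_def[abs_def] sat1_def using sat_pos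
  by (auto intro!: derivative_eq_intros simp: power2_eq_square)

lemma DERIV_sat1: "(sat1 e has_real_derivative sat2 e z) (at z)"
proof -
  have w: "1 + e * z \<noteq> 0" using sat_pos by linarith
  have "(sat1 e has_real_derivative (0 * (1 + e * z)\<^sup>2 - 1 * (2 * (1 + e * z) * e)) / ((1 + e * z)\<^sup>2 * (1 + e * z)\<^sup>2)) (at z)"
    unfolding sat1_def[abs_def] by (rule DERIV_divide) (use w in \<open>auto intro!: derivative_eq_intros\<close>)
  moreover have "(0 * w\<^sup>2 - 1 * (2 * w * e)) / (w\<^sup>2 * w\<^sup>2) = - 2 * e / w ^ 3" if "w \<noteq> 0" for w
    using that by (simp add: field_simps power2_eq_square power3_eq_cube)
  ultimately show ?thesis unfolding sat2_def using w by metis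
qed

lemma sat_bounds: "0 \<le> sat e z" "sat e z \<le> z" "sat e z \<le> 1 / e"
proof -
  show "0 \<le> sat e z" using e z by (simp add: sat_def)
  show "sat e z \<le> z" using z sat_pos mult_right_mono[OF sat_pos z] by (simp add: sat_def divide_le_eq mult.commute)
  show "sat e z \<le> 1 / e" using e sat_pos by (simp add: sat_def field_simps)
qed

lemma sat1_bounds: "0 \<le> sat1 e z" "sat1 e z \<le> 1"
  using one_le_power[OF sat_pos, of 2] by (auto simp: sat1_def divide_le_eq)

text \<open>The factor e z in the numerator is absorbed by (1 + e z)^3, whatever e is. The weight z
  is the one that \<open>gradient_sq_le\<close> supplies.\<close>

lemma sat2_bound: "\<bar>sat2 e z\<bar> * z \<le> 2"
proof -
  have "e * z \<le> 1 + e * z" by simp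
  also have "\<dots> \<le> (1 + e * z) ^ 3"
    using power_increasing[OF _ sat_pos, of 1 3] by simp
  finally show ?thesis
    using e sat_pos by (simp add: sat2_def abs_mult field_simps)
qed

lemma sat_Lipschitz:
  assumes "0 \<le> y"
  shows "\<bar>sat e y - sat e z\<bar> \<le> \<bar>y - z\<bar>"
proof -
  have y: "1 \<le> 1 + e * y" using e assms by simp
  have "sat e y - sat e z = (y - z) / ((1 + e * y) * (1 + e * z))"
    using sat_pos y by (simp add: sat_def field_simps)
  also have "\<bar>\<dots>\<bar> = \<bar>y - z\<bar> / ((1 + e * y) * (1 + e * z))"
    using sat_pos y by (simp add: abs_mult)
  also have "\<dots> \<le> \<bar>y - z\<bar> / 1"
    using mult_mono[OF y sat_pos] y by (intro divide_left_mono) auto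
  finally show ?thesis by simp
qed

end

lemma sat_limits:
  assumes "0 \<le> z"
  shows "(\<lambda>n. sat (1 / real (Suc n)) z) \<longlonglongrightarrow> z"
    and "(\<lambda>n. sat1 (1 / real (Suc n)) z) \<longlonglongrightarrow> 1"
    and "(\<lambda>n. sat2 (1 / real (Suc n)) z) \<longlonglongrightarrow> 0"
proof -
  have h: "(\<lambda>n. 1 / real (Suc n)) \<longlonglongrightarrow> 0" by (rule LIMSEQ_Suc[OF lim_1_over_n])
  have "(\<lambda>n. sat (1 / real (Suc n)) z) \<longlonglongrightarrow> z / (1 + 0 * z)"
    unfolding sat_def by (intro tendsto_intros h) auto
  then show "(\<lambda>n. sat (1 / real (Suc n)) z) \<longlonglongrightarrow> z" by simp
  have "(\<lambda>n. sat1 (1 / real (Suc n)) z) \<longlonglongrightarrow> 1 / (1 + 0 * z)\<^sup>2"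
    unfolding sat1_def by (intro tendsto_intros h) auto
  then show "(\<lambda>n. sat1 (1 / real (Suc n)) z) \<longlonglongrightarrow> 1" by simp
  have "(\<lambda>n. sat2 (1 / real (Suc n)) z) \<longlonglongrightarrow> - 2 * 0 / (1 + 0 * z) ^ 3"
    unfolding sat2_def by (intro tendsto_intros h) auto
  then show "(\<lambda>n. sat2 (1 / real (Suc n)) z) \<longlonglongrightarrow> 0" by simp
qed

definition sat_dt :: "(real \<Rightarrow> real^'n \<Rightarrow> real) \<Rightarrow> real \<Rightarrow> real \<times> (real^'n) \<Rightarrow> real" where
  "sat_dt f e z = sat1 e (f (fst z) (snd z)) * dt f (fst z) (snd z)"

text \<open>With \<open>sat_dt\<close>, the derivatives of \<open>sat e\<close> composed with f by
  the chain rule. As explicit formulas on space-time points they allow the limit e \<rightarrow> 0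
  to be taken term by term.\<close>

definition sat_hessian :: "(real \<Rightarrow> real^'n \<Rightarrow> real) \<Rightarrow> real \<Rightarrow> real \<times> (real^'n) \<Rightarrow> real^'n^'n" where
  "sat_hessian f e z = sat1 e (f (fst z) (snd z)) *\<^sub>R hessian (f (fst z)) (snd z) +
    sat2 e (f (fst z) (snd z)) *\<^sub>R outer (gradient (f (fst z)) (snd z))"

section \<open>Saturated test functions and their cut-off in time\<close>

context
  fixes s t :: real and f :: "real \<Rightarrow> real^'n \<Rightarrow> real" and e C :: real
  assumes f: "C12b s t f" and nonneg: "\<And>r x. r \<in> {s..t} \<Longrightarrow> 0 \<le> f r x"
    and C: "0 < C" "\<And>r x. r \<in> {s<..<t} \<Longrightarrow> \<bar>dt f r x\<bar> \<le> C"
      "\<And>r x. r \<in> {s<..<t} \<Longrightarrow> norm (hessian (f r) x) \<le> C"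
    and e: "0 < e"
begin

lemma f_nonneg: "r \<in> {s<..<t} \<Longrightarrow> 0 \<le> f r x"
  using nonneg by simp

lemma continuous_on_f_open: "continuous_on ({s<..<t} \<times> UNIV) (\<lambda>z. f (fst z) (snd z))"
  using C12b_cont(1)[OF f] unfolding case_prod_unfold by (rule continuous_on_subset) auto

lemma sat_nonzero: "z \<in> {s<..<t} \<times> UNIV \<Longrightarrow> 1 + e * f (fst z) (snd z) \<noteq> 0"
  using sat_pos[OF e f_nonneg, of "fst z" "snd z"] by auto

lemma continuous_on_sat:
  "continuous_on ({s<..<t} \<times> UNIV) (\<lambda>z. sat e (f (fst z) (snd z)))"
  "continuous_on ({s<..<t} \<times> UNIV) (\<lambda>z. sat1 e (f (fst z) (snd z)))"
  "continuous_on ({s<..<t} \<times> UNIV) (\<lambda>z. sat2 e (f (fst z) (snd z)))"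
  "continuous_on ({s<..<t} \<times> UNIV) (sat_dt f e)"
  "continuous_on ({s<..<t} \<times> UNIV) (sat_hessian f e)"
proof -
  show 1: "continuous_on ({s<..<t} \<times> UNIV) (\<lambda>z. sat e (f (fst z) (snd z)))"
    "continuous_on ({s<..<t} \<times> UNIV) (\<lambda>z. sat1 e (f (fst z) (snd z)))"
    "continuous_on ({s<..<t} \<times> UNIV) (\<lambda>z. sat2 e (f (fst z) (snd z)))"
    unfolding sat_def sat1_def sat2_def using sat_nonzero
    by (auto intro!: continuous_intros continuous_on_f_open)
  show "continuous_on ({s<..<t} \<times> UNIV) (sat_dt f e)" "continuous_on ({s<..<t} \<times> UNIV) (sat_hessian f e)"
    unfolding sat_dt_def[abs_def] sat_hessian_def[abs_def]
    using C12b_cont[OF f] 1 by (auto intro!: continuous_intros simp: case_prod_unfold)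
qed

lemma sat_dt_bound:
  assumes z: "z \<in> {s<..<t} \<times> UNIV"
  shows "\<bar>sat_dt f e z\<bar> \<le> C"
proof -
  have r: "fst z \<in> {s<..<t}" using z by auto
  have "\<bar>sat_dt f e z\<bar> \<le> 1 * C"
    unfolding sat_dt_def abs_mult
    using sat1_bounds[OF e f_nonneg[OF r, of "snd z"]] C(2)[OF r, of "snd z"] by (intro mult_mono) auto
  then show ?thesis by simp
qed

text \<open>The constant is 1 + 4 * 2: \<open>sat1\<close> is at most 1 on the Hessian term, and the
  outer product costs 4 C f from \<open>gradient_sq_le\<close> times the bound 2 on
  |\<open>sat2\<close>| f.\<close>

lemma sat_hessian_bound:
  assumes z: "z \<in> {s<..<t} \<times> UNIV"
  shows "norm (sat_hessian f e z) \<le> 9 * C"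
proof -
  let ?f = "f (fst z) (snd z)"
  have r: "fst z \<in> {s<..<t}" using z by auto
  note f0 = f_nonneg[OF r, of "snd z"]
  have "norm (sat1 e ?f *\<^sub>R hessian (f (fst z)) (snd z)) \<le> 1 * C"
    unfolding norm_scaleR using sat1_bounds[OF e f0] C(3)[OF r, of "snd z"] by (intro mult_mono) auto
  moreover have "norm (sat2 e ?f *\<^sub>R outer (gradient (f (fst z)) (snd z))) \<le> 8 * C"
  proof -
    have "norm (sat2 e ?f *\<^sub>R outer (gradient (f (fst z)) (snd z))) = \<bar>sat2 e ?f\<bar> * (norm (gradient (f (fst z)) (snd z)))\<^sup>2"
      by (simp add: norm_outer)
    also have "\<dots> \<le> \<bar>sat2 e ?f\<bar> * (4 * C * ?f)"
      using twice_diff.gradient_sq_le[OF C12b_twice_diff[OF f r] C(3)[OF r] C(1) f_nonneg[OF r]]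
      by (intro mult_left_mono) auto
    also have "\<dots> = 4 * C * (\<bar>sat2 e ?f\<bar> * ?f)" by simp
    also have "\<dots> \<le> 4 * C * 2"
      using sat2_bound[OF e f0] C(1) by (intro mult_left_mono) auto
    finally show ?thesis by simp
  qed
  ultimately show ?thesis
    unfolding sat_hessian_def by (intro order_trans[OF norm_triangle_ineq]) linarith
qed

text \<open>Outside [s',t'] the factor \<eta> kills whatever f does, so the product extends by zero
  to [0,1]. On (s,t) the product and chain rules apply.\<close>

lemma cutoff_C12b:
  fixes \<eta> \<eta>' :: "real \<Rightarrow> real"
  assumes \<eta>: "\<And>r. (\<eta> has_real_derivative \<eta>' r) (at r)" "continuous_on UNIV \<eta>'"
    and \<eta>_le: "\<And>r. \<bar>\<eta> r\<bar> \<le> 1" and \<eta>'_le: "\<And>r. \<bar>\<eta>' r\<bar> \<le> D"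
    and supp: "\<And>r. r \<notin> {s'..t'} \<Longrightarrow> \<eta> r = 0" and st: "s < s'" "t' < t"
  defines "\<Psi> \<equiv> (\<lambda>r x. \<eta> r * sat e (f r x))"
  shows "C12b 0 1 \<Psi>"
    and "\<And>r x. r \<in> {0<..<1} \<Longrightarrow> dt \<Psi> r x = \<eta>' r * sat e (f r x) + \<eta> r * sat_dt f e (r, x)"
    and "\<And>r x. r \<in> {0<..<1} \<Longrightarrow> hessian (\<Psi> r) x = \<eta> r *\<^sub>R sat_hessian f e (r, x)"
    and "\<And>r. r \<notin> {s'..t'} \<Longrightarrow> \<eta>' r = 0"
proof -
  show supp': "\<eta>' r = 0" if "r \<notin> {s'..t'}" for r
  proof -
    have "((\<lambda>_. 0) has_real_derivative 0) (at r)" by simp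
    then have "(\<eta> has_real_derivative 0) (at r)"
      by (rule has_field_derivative_transform_within_open[where S = "- {s'..t'}"]) (use that supp in auto)
    with \<eta>(1) show ?thesis by (rule DERIV_unique)
  qed
  define d where "d r x = \<eta>' r * sat e (f r x) + \<eta> r * sat_dt f e (r, x)" for r x
  define g where "g r x = (\<eta> r * sat1 e (f r x)) *\<^sub>R gradient (f r) x" for r x
  define H where "H r x = \<eta> r *\<^sub>R sat_hessian f e (r, x)" for r x
  have cont_\<eta>: "continuous_on S \<eta>" for S
    using \<eta>(1) by (meson DERIV_isCont continuous_at_imp_continuous_on)
  have cases: "r \<in> {s<..<t} \<or> r \<notin> {s'..t'}" for r using st by auto
  \<comment> \<open>Gluing over two open sets, (s,t) and the complement of [s',t'], which cover the
    line because s < s' and t' < t.\<close>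
  have extend: "continuous_on UNIV k"
    if "continuous_on ({s<..<t} \<times> UNIV) k" "\<And>z. fst z \<notin> {s'..t'} \<Longrightarrow> k z = 0"
    for k :: "real \<times> (real^'n) \<Rightarrow> 'b::real_normed_vector"
  proof -
    have "continuous_on ((- {s'..t'}) \<times> UNIV) k"
      by (rule continuous_on_eq[OF continuous_on_const[of _ 0]]) (use that(2) in auto)
    then have "continuous_on ({s<..<t} \<times> UNIV \<union> (- {s'..t'}) \<times> UNIV) k"
      by (intro continuous_on_open_Un that) (auto intro!: open_Times)
    moreover have "{s<..<t} \<times> UNIV \<union> (- {s'..t'}) \<times> UNIV = (UNIV :: (real \<times> (real^'n)) set)"
      using st by auto
    ultimately show ?thesis by simp
  qed
  have cont_fst: "continuous_on S (\<lambda>z. \<eta> (fst z))" "continuous_on S (\<lambda>z. \<eta>' (fst z))"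
    for S :: "(real \<times> (real^'n)) set"
    by (auto intro!: continuous_on_compose2[OF cont_\<eta>[of UNIV]] continuous_on_compose2[OF \<eta>(2)] continuous_intros)
  note cs = continuous_on_sat cont_fst
  have c: "continuous_on UNIV (\<lambda>z. \<Psi> (fst z) (snd z))" "continuous_on UNIV (\<lambda>z. d (fst z) (snd z))"
    "continuous_on UNIV (\<lambda>z. g (fst z) (snd z))" "continuous_on UNIV (\<lambda>z. H (fst z) (snd z))"
  proof -
    show "continuous_on UNIV (\<lambda>z. \<Psi> (fst z) (snd z))"
      unfolding \<Psi>_def by (rule extend) (auto intro!: continuous_intros cs simp: supp)
    show "continuous_on UNIV (\<lambda>z. d (fst z) (snd z))"
      unfolding d_def by (rule extend) (auto intro!: continuous_intros cs simp: supp supp')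
    have "continuous_on ({s<..<t} \<times> UNIV) (\<lambda>z. gradient (f (fst z)) (snd z))"
      using C12b_cont(3)[OF f] by (simp add: case_prod_unfold)
    then show "continuous_on UNIV (\<lambda>z. g (fst z) (snd z))"
      unfolding g_def by (intro extend) (auto intro!: continuous_intros cs simp: supp)
    show "continuous_on UNIV (\<lambda>z. H (fst z) (snd z))"
      unfolding H_def by (rule extend) (auto intro!: continuous_intros cs simp: supp)
  qed
  have dd: "((\<lambda>r. \<Psi> r x) has_real_derivative d r x) (at r)" for r x
  proof (cases "r \<in> {s<..<t}")
    case True
    have "((\<lambda>r. sat e (f r x)) has_real_derivative sat1 e (f r x) * dt f r x) (at r)"
      using DERIV_chain2[OF DERIV_sat[OF e f_nonneg[OF True]] C12b_dt[OF f True]] .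
    from DERIV_mult[OF \<eta>(1)[of r] this] show ?thesis
      by (simp add: \<Psi>_def d_def sat_dt_def mult_ac)
  next
    case False
    with st have r: "r \<in> - {s'..t'}" by auto
    have "((\<lambda>_. 0) has_real_derivative d r x) (at r)"
      using r supp supp' by (simp add: d_def)
    then show ?thesis
      by (rule has_field_derivative_transform_within_open[where S = "- {s'..t'}"]) (use r supp in \<open>auto simp: \<Psi>_def\<close>)
  qed
  have gg: "GDERIV (\<Psi> r) x :> g r x" for r x
  proof (cases "r \<in> {s<..<t}")
    case True
    show ?thesis
      unfolding \<Psi>_def g_def
      by (rule GDERIV_scale_compose[OF C12b_gradient[OF f True] DERIV_sat[OF e f_nonneg[OF True]]])
  next
    case False
    with cases supp have "\<eta> r = 0" by blast
    then show ?thesis by (simp add: \<Psi>_def g_def GDERIV_const)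
  qed
  have HH: "(g r has_derivative (\<lambda>h. H r x *v h)) (at x)" for r x
  proof (cases "r \<in> {s<..<t}")
    case True
    have "(g r has_derivative (\<lambda>h. ((\<eta> r * sat1 e (f r x)) *\<^sub>R hessian (f r) x +
        (\<eta> r * sat2 e (f r x)) *\<^sub>R outer (gradient (f r) x)) *v h)) (at x)"
      unfolding g_def
      by (rule has_derivative_scale_gradient[OF C12b_gradient[OF f True] C12b_hessian[OF f True] DERIV_sat1[OF e f_nonneg[OF True]]])
    then show ?thesis by (simp add: H_def sat_hessian_def scaleR_add_right)
  next
    case False
    with cases supp have "\<eta> r = 0" by blast
    then show ?thesis by (simp add: H_def g_def[abs_def])
  qed
  have D0: "0 \<le> D" using \<eta>'_le[of 0] by linarith
  \<comment> \<open>D / e is the price of the time cut-off: \<eta>' multiplies the saturated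
    function, which is at most 1 / e.\<close>
  have bounds: "\<bar>d r x\<bar> \<le> D / e + 9 * C \<and> norm (H r x) \<le> D / e + 9 * C" for r x
  proof (cases "r \<in> {s<..<t}")
    case True
    have "\<bar>\<eta>' r * sat e (f r x)\<bar> \<le> D * (1 / e)"
      using \<eta>'_le[of r] sat_bounds[OF e f_nonneg[OF True, of x]] D0 by (simp only: abs_mult) (intro mult_mono; simp)
    moreover have "\<bar>\<eta> r * sat_dt f e (r, x)\<bar> \<le> 1 * C"
      using \<eta>_le[of r] sat_dt_bound[of "(r, x)"] True C(1) by (simp only: abs_mult) (intro mult_mono; simp)
    moreover have "norm (H r x) \<le> 1 * (9 * C)"
      unfolding H_def norm_scaleR using \<eta>_le[of r] sat_hessian_bound[of "(r, x)"] True C(1)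
      by (intro mult_mono; simp)
    moreover have "0 \<le> D / e" using D0 e by simp
    ultimately show ?thesis using C(1) by (simp add: d_def)
  next
    case False
    with cases have "r \<notin> {s'..t'}" by blast
    then show ?thesis using D0 e C(1) supp supp' by (simp add: d_def H_def)
  qed
  note rules = C12bI[where \<phi> = \<Psi> and s = 0 and t = 1 and d = d and g = g and H = H and C = "D / e + 9 * C"]
  note prems = c[THEN continuous_on_subset, OF subset_UNIV] dd gg HH bounds[THEN conjunct1] bounds[THEN conjunct2]
  show "C12b 0 1 \<Psi>" using prems by (intro rules(1)) (auto simp: case_prod_unfold)
  show "dt \<Psi> r x = \<eta>' r * sat e (f r x) + \<eta> r * sat_dt f e (r, x)" if "r \<in> {0<..<1}" for r x
    using prems that unfolding d_def[symmetric] by (intro rules(2)) (auto simp: case_prod_unfold)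
  show "hessian (\<Psi> r) x = \<eta> r *\<^sub>R sat_hessian f e (r, x)" if "r \<in> {0<..<1}" for r x
    using prems that unfolding H_def[symmetric] by (intro rules(4)) (auto simp: case_prod_unfold)
qed

end

section \<open>Restricting a solution to a subinterval\<close>

locale FPE_curve =
  fixes \<rho> :: "real \<Rightarrow> (real^'n) measure" and a :: "real \<Rightarrow> real^'n \<Rightarrow> real^'n^'n"
  assumes sol: "FPE_solution 0 1 \<rho> a"

sublocale FPE_curve \<subseteq> P2_curve
  using sol by unfold_locales (simp add: FPE_solution_def)

context FPE_curve
begin

text \<open>The coefficient is constrained on (0,1) only; extension by zero yields a Borel map on
  all of space-time.\<close>

definition A :: "real \<times> (real^'n) \<Rightarrow> real^'n^'n" where
  "A z = indicator ({0<..<1} \<times> UNIV) z *\<^sub>R a (fst z) (snd z)"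

lemma A_eq: "r \<in> {0<..<1} \<Longrightarrow> A (r, x) = a r x"
  by (simp add: A_def)

lemma a_Sym: "r \<in> {0<..<1} \<Longrightarrow> a r x \<in> Sym"
  using sol by (auto simp: FPE_solution_def Sym_nonneg_def)

lemma A_measurable [measurable]: "A \<in> borel_measurable borel"
proof -
  have "(\<lambda>(r, x). a r x) \<in> borel_measurable (restrict_space borel ({0<..<1} \<times> UNIV))"
    using sol by (simp add: FPE_solution_def)
  then show ?thesis
    by (subst (asm) borel_measurable_restrict_space_iff)
       (auto simp: A_def[abs_def] case_prod_unfold open_Times)
qed

lemma A_integrable: "integrable spacetime A"
proof (rule integrableI_bounded)
  have "(\<integral>\<^sup>+z. ennreal (norm (A z)) \<partial>spacetime) =
      (\<integral>\<^sup>+r\<in>{0<..<1}. (\<integral>\<^sup>+x. ennreal (norm (A (r, x))) \<partial>\<rho> r) \<partial>lborel)"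
    by (rule nn_integral_spacetime) measurable
  also have "\<dots> = (\<integral>\<^sup>+r\<in>{0<..<1}. (\<integral>\<^sup>+x. ennreal (norm (a r x)) \<partial>\<rho> r) \<partial>lborel)"
    by (intro nn_integral_cong) (auto simp: indicator_def A_eq)
  also have "\<dots> < \<infinity>" using sol by (simp add: FPE_solution_def)
  finally show "(\<integral>\<^sup>+z. ennreal (norm (A z)) \<partial>spacetime) < \<infinity>" .
qed simp

text \<open>The integrand of the weak equation with d and H left free, so that it also covers
  \<open>sat_dt\<close> and \<open>sat_hessian\<close>; it is localised to (s,t) by an indicator so
  that every integral is over the same measure.\<close>

definition weak_density :: "real \<Rightarrow> real \<Rightarrow> (real \<times> (real^'n) \<Rightarrow> real) \<Rightarrow> (real \<times> (real^'n) \<Rightarrow> real^'n^'n) \<Rightarrow>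
    real \<times> (real^'n) \<Rightarrow> real" where
  "weak_density s t d H z = indicator ({s<..<t} \<times> UNIV) z * (d z + A z \<bullet> ((1/2) *\<^sub>R H z))"

lemma indicator_measurable:
  fixes k :: "real \<times> (real^'n) \<Rightarrow> 'b::real_normed_vector"
  assumes "continuous_on ({s<..<t} \<times> UNIV) k"
  shows "(\<lambda>z. indicator ({s<..<t} \<times> UNIV) z *\<^sub>R k z) \<in> borel_measurable borel"
  using assms by (intro borel_measurable_continuous_on_indicator) (auto simp: open_Times)

lemma weak_density_measurable:
  assumes "continuous_on ({s<..<t} \<times> UNIV) d" "continuous_on ({s<..<t} \<times> UNIV) H"
  shows "weak_density s t d H \<in> borel_measurable borel"
proof -
  note [measurable] = assms[THEN indicator_measurable]
  have eq: "weak_density s t d H = (\<lambda>z. indicator ({s<..<t} \<times> UNIV) z *\<^sub>R d z +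
      A z \<bullet> ((1/2) *\<^sub>R (indicator ({s<..<t} \<times> UNIV) z *\<^sub>R H z)))"
    by (auto simp: weak_density_def[abs_def] indicator_def fun_eq_iff)
  show ?thesis unfolding eq by measurable
qed

text \<open>The majorant is integrable because space-time has finite mass and A is
  integrable.\<close>

lemma weak_density_bound:
  assumes "0 \<le> C" "\<And>z. z \<in> {s<..<t} \<times> UNIV \<Longrightarrow> \<bar>d z\<bar> \<le> C" "\<And>z. z \<in> {s<..<t} \<times> UNIV \<Longrightarrow> norm (H z) \<le> C"
  shows "\<bar>weak_density s t d H z\<bar> \<le> C + C * norm (A z)"
proof (cases "z \<in> {s<..<t} \<times> UNIV")
  case True
  have "\<bar>A z \<bullet> ((1/2) *\<^sub>R H z)\<bar> \<le> norm (A z) * norm ((1/2) *\<^sub>R H z)"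
    by (rule Cauchy_Schwarz_ineq2)
  also have "\<dots> \<le> norm (A z) * C"
    using assms(3)[OF True] assms(1) by (intro mult_left_mono) auto
  finally show ?thesis
    using assms(2)[OF True] True abs_triangle_ineq[of "d z" "A z \<bullet> ((1/2) *\<^sub>R H z)"]
    by (simp add: weak_density_def mult.commute)
qed (use assms in \<open>simp add: weak_density_def\<close>)

lemma bound_integrable: "integrable spacetime (\<lambda>z. C + C * norm (A z))"
proof -
  interpret finite_measure spacetime by (rule finite_spacetime)
  show ?thesis using A_integrable by simp
qed

lemma weak_density_integrable:
  assumes "continuous_on ({s<..<t} \<times> UNIV) d" "continuous_on ({s<..<t} \<times> UNIV) H"
    and "0 \<le> C" "\<And>z. z \<in> {s<..<t} \<times> UNIV \<Longrightarrow> \<bar>d z\<bar> \<le> C" "\<And>z. z \<in> {s<..<t} \<times> UNIV \<Longrightarrow> norm (H z) \<le> C"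
  shows "integrable spacetime (weak_density s t d H)"
proof (rule Bochner_Integration.integrable_bound[OF bound_integrable[of C]])
  show "weak_density s t d H \<in> borel_measurable spacetime"
    using weak_density_measurable[OF assms(1,2)] by simp
  show "AE z in spacetime. norm (weak_density s t d H z) \<le> norm (C + C * norm (A z))"
    using weak_density_bound[OF assms(3-5)] assms(3) by (auto intro!: always_eventually order_trans[OF _ abs_ge_self])
qed

abbreviation test_density :: "real \<Rightarrow> real \<Rightarrow> (real \<Rightarrow> real^'n \<Rightarrow> real) \<Rightarrow> real \<times> (real^'n) \<Rightarrow> real" where
  "test_density s t \<psi> \<equiv> weak_density s t (\<lambda>z. dt \<psi> (fst z) (snd z)) (\<lambda>z. hessian (\<psi> (fst z)) (snd z))"

lemma test_density_integrable:
  assumes \<psi>: "C12b s t \<psi>"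
  shows "integrable spacetime (test_density s t \<psi>)"
proof -
  obtain C where "0 < C" "\<And>r x. r \<in> {s<..<t} \<Longrightarrow> \<bar>dt \<psi> r x\<bar> \<le> C"
    "\<And>r x. r \<in> {s<..<t} \<Longrightarrow> norm (hessian (\<psi> r) x) \<le> C"
    using C12b_bounds[OF \<psi>] by metis
  then show ?thesis
    using C12b_cont[OF \<psi>] by (intro weak_density_integrable[where C = C]) (auto simp: case_prod_unfold)
qed

lemma integral_test_density:
  assumes \<psi>: "C12b s t \<psi>" and st: "0 \<le> s" "t \<le> 1"
  shows "(LINT z|spacetime. test_density s t \<psi> z) =
    (LINT r:{s<..<t}|lborel. LINT x|\<rho> r. dt \<psi> r x + trace (((1/2) *\<^sub>R a r x) ** hessian (\<psi> r) x))"
proof -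
  have "(LINT z|spacetime. test_density s t \<psi> z) =
    (LINT r:{s<..<t}|lborel. LINT x|\<rho> r. dt \<psi> r x + A (r, x) \<bullet> ((1/2) *\<^sub>R hessian (\<psi> r) x))"
    using integral_spacetime_subinterval[OF st, of "\<lambda>z. dt \<psi> (fst z) (snd z) + A z \<bullet> ((1/2) *\<^sub>R hessian (\<psi> (fst z)) (snd z))"]
      test_density_integrable[OF \<psi>]
    by (simp add: weak_density_def[abs_def])
  also have "\<dots> = (LINT r:{s<..<t}|lborel. LINT x|\<rho> r. dt \<psi> r x + trace (((1/2) *\<^sub>R a r x) ** hessian (\<psi> r) x))"
  proof (intro set_lebesgue_integral_cong allI impI)
    fix r assume "r \<in> {s<..<t}"
    then have r: "r \<in> {0<..<1}" using st by auto
    show "(LINT x|\<rho> r. dt \<psi> r x + A (r, x) \<bullet> ((1/2) *\<^sub>R hessian (\<psi> r) x)) =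
      (LINT x|\<rho> r. dt \<psi> r x + trace (((1/2) *\<^sub>R a r x) ** hessian (\<psi> r) x))"
      unfolding trace_mult_half_Sym[OF a_Sym[OF r]] A_eq[OF r] ..
  qed simp
  finally show ?thesis .
qed

lemma test_equation:
  assumes "C12b 0 1 \<psi>"
  shows "(LINT z|spacetime. test_density 0 1 \<psi> z) = (LINT x|\<rho> 1. \<psi> 1 x) - (LINT x|\<rho> 0. \<psi> 0 x)"
  unfolding integral_test_density[OF assms order_refl order_refl]
  using sol assms unfolding FPE_solution_def by blast

lemma prob_\<rho>: "r \<in> {0..1} \<Longrightarrow> prob_space (\<rho> r)"
  using \<rho>_P2 by (simp add: P2_def)

lemma integrable_quadratic:
  assumes r: "r \<in> {0..1}" and f: "continuous_on UNIV f" "\<And>x. \<bar>f x\<bar> \<le> M * (1 + (norm x)\<^sup>2)"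
  shows "integrable (\<rho> r) (f :: real^'n \<Rightarrow> real)"
proof (rule Bochner_Integration.integrable_bound[where f = "\<lambda>x. M * (1 + (norm x)\<^sup>2)"])
  interpret prob_space "\<rho> r" using \<rho>_P2[OF r] by (simp add: P2_def)
  have sets: "sets (\<rho> r) = sets borel" and "integrable (\<rho> r) (\<lambda>x. (norm x)\<^sup>2)"
    using \<rho>_P2[OF r] by (simp_all add: P2_def)
  then show "integrable (\<rho> r) (\<lambda>x. M * (1 + (norm x)\<^sup>2))" by simp
  show "f \<in> borel_measurable (\<rho> r)"
    using borel_measurable_continuous_onI[OF f(1)] sets by (simp cong: measurable_cong_sets)
  show "AE x in \<rho> r. norm (f x) \<le> norm (M * (1 + (norm x)\<^sup>2))"
    using f(2) by (auto intro!: always_eventually order_trans[OF _ abs_ge_self])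
qed

section \<open>The equation on [s,t] for a non-negative test function\<close>

context
  fixes s t :: real and f :: "real \<Rightarrow> real^'n \<Rightarrow> real" and C :: real
  assumes st: "0 \<le> s" "s < t" "t \<le> 1"
    and f: "C12b s t f" and nonneg: "\<And>r x. r \<in> {s..t} \<Longrightarrow> 0 \<le> f r x"
    and C: "0 < C" "\<And>r x. r \<in> {s<..<t} \<Longrightarrow> \<bar>dt f r x\<bar> \<le> C"
      "\<And>r x. r \<in> {s<..<t} \<Longrightarrow> norm (hessian (f r) x) \<le> C"
begin

lemma continuous_on_f_slice: "r \<in> {s..t} \<Longrightarrow> continuous_on UNIV (f r)"
  by (rule C12b_continuous_slice[OF f])

lemma continuous_on_sat_slice:
  assumes e: "0 < e" and r: "r \<in> {s..t}"
  shows "continuous_on UNIV (\<lambda>x. sat e (f r x))"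
proof -
  have "1 + e * f r x \<noteq> 0" for x
    using sat_pos[OF e nonneg[OF r]] by (metis not_one_le_zero)
  then show ?thesis
    unfolding sat_def using continuous_on_f_slice[OF r] by (intro continuous_intros) auto
qed

lemma sat_slice_abs_le:
  assumes e: "0 < e" and r: "r \<in> {s..t}"
  shows "\<bar>sat e (f r x)\<bar> \<le> 1 / e"
  using sat_bounds[OF e nonneg[OF r]] by simp

lemma integrable_sat:
  assumes e: "0 < e" and r: "r \<in> {s..t}" "r' \<in> {0..1}"
  shows "integrable (\<rho> r') (\<lambda>x. sat e (f r x))"
proof (rule integrable_quadratic[OF r(2) continuous_on_sat_slice[OF e r(1)]])
  fix x :: "real^'n"
  have "1 / e * 1 \<le> 1 / e * (1 + (norm x)\<^sup>2)"
    using e by (intro mult_left_mono) auto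
  then show "\<bar>sat e (f r x)\<bar> \<le> 1 / e * (1 + (norm x)\<^sup>2)"
    using sat_slice_abs_le[OF e r(1), of x] by linarith
qed

text \<open>Both the measure and the integrand move with r. With the integrand frozen at r0, narrow
  continuity applies because it is bounded and continuous; unfreezing costs at most C |r - r0|,
  since each \<open>\<rho> r\<close> has mass 1.\<close>

lemma continuous_on_sat_integral:
  assumes e: "0 < e"
  shows "continuous_on {s..t} (\<lambda>r. LINT x|\<rho> r. sat e (f r x))"
  unfolding continuous_on_def
proof
  fix r0 assume r0: "r0 \<in> {s..t}"
  define J where "J r = (LINT x|\<rho> r. sat e (f r0 x))" for r
  have "continuous_on {0..1} J"
  proof -
    have "bounded (range (\<lambda>x. sat e (f r0 x)))"
      using sat_slice_abs_le[OF e r0] by (auto intro!: boundedI)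
    then show ?thesis
      using cont continuous_on_sat_slice[OF e r0]
      unfolding continuous_map_P2_topology_iff J_def by auto
  qed
  then have "continuous_on {s..t} J" by (rule continuous_on_subset) (use st in auto)
  then have J: "(J \<longlongrightarrow> J r0) (at r0 within {s..t})"
    using r0 by (simp add: continuous_on_def)
  have diff: "((\<lambda>r. (LINT x|\<rho> r. sat e (f r x)) - J r) \<longlongrightarrow> 0) (at r0 within {s..t})"
  proof (rule Lim_null_comparison)
    show "((\<lambda>r. C * \<bar>r - r0\<bar>) \<longlongrightarrow> 0) (at r0 within {s..t})"
      by (auto intro!: tendsto_eq_intros)
    have "norm ((LINT x|\<rho> r. sat e (f r x)) - J r) \<le> C * \<bar>r - r0\<bar>" if r: "r \<in> {s..t}" for r
    proof -
      have r1: "r \<in> {0..1}" using r st by auto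
      interpret prob_space "\<rho> r" using prob_\<rho>[OF r1] .
      note i = integrable_sat[OF e r r1] integrable_sat[OF e r0 r1]
      have "norm ((LINT x|\<rho> r. sat e (f r x)) - J r) = norm (LINT x|\<rho> r. sat e (f r x) - sat e (f r0 x))"
        using i by (simp add: J_def)
      also have "\<dots> \<le> (LINT x|\<rho> r. norm (sat e (f r x) - sat e (f r0 x)))"
        by (rule integral_norm_bound)
      also have "\<dots> \<le> (LINT x|\<rho> r. C * \<bar>r - r0\<bar>)"
      proof (rule integral_mono)
        fix x
        have "\<bar>sat e (f r x) - sat e (f r0 x)\<bar> \<le> \<bar>f r x - f r0 x\<bar>"
          by (rule sat_Lipschitz[OF e nonneg[OF r0] nonneg[OF r]])
        also have "\<dots> \<le> C * \<bar>r - r0\<bar>"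
          by (rule C12b_Lipschitz_time[OF f C(2) r r0])
        finally show "norm (sat e (f r x) - sat e (f r0 x)) \<le> C * \<bar>r - r0\<bar>" by simp
      qed (use i in auto)
      also have "\<dots> = C * \<bar>r - r0\<bar>" by (simp add: prob_space)
      finally show ?thesis .
    qed
    then show "eventually (\<lambda>r. norm ((LINT x|\<rho> r. sat e (f r x)) - J r) \<le> C * \<bar>r - r0\<bar>) (at r0 within {s..t})"
      by (simp add: eventually_at_filter)
  qed
  show "((\<lambda>r. LINT x|\<rho> r. sat e (f r x)) \<longlongrightarrow> (LINT x|\<rho> r0. sat e (f r0 x))) (at r0 within {s..t})"
    using tendsto_add[OF diff J] by (simp add: J_def)
qed

text \<open>Testing the equation on (0,1) with \<eta> times the saturated f: the boundary terms
  vanish, and the product rule leaves the \<eta>' term on one side and the cut-off weak density on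
  the other.\<close>

lemma sat_cutoff_equation:
  assumes e: "0 < e"
    and \<eta>: "\<And>r. (\<eta> has_real_derivative \<eta>' r) (at r)" "continuous_on UNIV \<eta>'"
    and \<eta>_le: "\<And>r. \<bar>\<eta> r\<bar> \<le> 1" and \<eta>'_le: "\<And>r. \<bar>\<eta>' r\<bar> \<le> D"
    and supp: "\<And>r. r \<notin> {s'..t'} \<Longrightarrow> \<eta> r = 0" and st': "s < s'" "t' < t"
  shows "(LINT r:{s<..<t}|lborel. \<eta>' r * (LINT x|\<rho> r. sat e (f r x))) =
    - (LINT z|spacetime. \<eta> (fst z) * weak_density s t (sat_dt f e) (sat_hessian f e) z)"
proof -
  let ?\<Psi> = "\<lambda>r x. \<eta> r * sat e (f r x)"
  note \<Psi> = cutoff_C12b[OF f nonneg C e \<eta> \<eta>_le \<eta>'_le supp st']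
  let ?I = "indicator ({s<..<t} \<times> UNIV) :: real \<times> (real^'n) \<Rightarrow> real"
  let ?h = "weak_density s t (sat_dt f e) (sat_hessian f e)"
  let ?g = "\<lambda>z. ?I z * (\<eta>' (fst z) * sat e (f (fst z) (snd z)))"
  note cs = continuous_on_sat[OF f nonneg C e]
  have cont_\<eta>: "continuous_on UNIV \<eta>"
    using \<eta>(1) by (meson DERIV_isCont continuous_at_imp_continuous_on)
  have D0: "0 \<le> D" using \<eta>'_le[of 0] by linarith
  have h: "integrable spacetime ?h"
    using C(1) sat_dt_bound[OF f nonneg C e] sat_hessian_bound[OF f nonneg C e]
    by (intro weak_density_integrable[where C = "9 * C"] cs) (auto intro: order_trans[where y = C])
  have \<eta>fst: "(\<lambda>z. \<eta> (fst z)) \<in> borel_measurable (borel :: (real \<times> (real^'n)) measure)"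
    by (intro borel_measurable_continuous_onI continuous_on_compose2[OF cont_\<eta>] continuous_intros) auto
  have \<eta>h: "integrable spacetime (\<lambda>z. \<eta> (fst z) * ?h z)"
  proof (rule Bochner_Integration.integrable_bound[OF h])
    show "(\<lambda>z. \<eta> (fst z) * ?h z) \<in> borel_measurable spacetime"
      using \<eta>fst borel_measurable_integrable[OF h] by simp
    show "AE z in spacetime. norm (\<eta> (fst z) * ?h z) \<le> norm (?h z)"
    proof (intro always_eventually allI)
      fix z show "norm (\<eta> (fst z) * ?h z) \<le> norm (?h z)"
        using mult_right_mono[OF \<eta>_le[of "fst z"] abs_ge_zero[of "?h z"]] by (simp add: abs_mult)
    qed
  qed
  have g: "integrable spacetime ?g"
  proof -
    interpret finite_measure spacetime by (rule finite_spacetime)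
    show ?thesis
    proof (rule integrable_const_bound[where B = "D * (1 / e)"])
      have "(\<lambda>z. ?I z *\<^sub>R (\<eta>' (fst z) * sat e (f (fst z) (snd z)))) \<in> borel_measurable borel"
        by (intro indicator_measurable continuous_intros cs continuous_on_compose2[OF \<eta>(2)]) auto
      then show "?g \<in> borel_measurable spacetime" by simp
      have "norm (?g z) \<le> D * (1 / e)" for z
      proof (cases "z \<in> {s<..<t} \<times> UNIV")
        case True
        then have "fst z \<in> {s..t}" by auto
        with True show ?thesis
          using \<eta>'_le sat_slice_abs_le[OF e, of "fst z" "snd z"] D0 
          by (simp only: indicator_simps real_norm_def abs_mult mult_1 abs_one) (intro mult_mono; simp)
      qed (use D0 e in simp)
      then show "AE z in spacetime. norm (?g z) \<le> D * (1 / e)" by simp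
    qed
  qed
  have eq: "test_density 0 1 ?\<Psi> z = ?g z + \<eta> (fst z) * ?h z" for z
  proof (cases "fst z \<in> {s<..<t}")
    case True
    then have "fst z \<in> {0<..<1}" "z \<in> {s<..<t} \<times> UNIV" "z \<in> {0<..<1} \<times> UNIV" using st by (auto simp: mem_Times_iff)
    then show ?thesis
      using \<Psi>(2,3)[of "fst z" "snd z"] by (simp add: weak_density_def algebra_simps)
  next
    case False
    then have "fst z \<notin> {s'..t'}" using st' by auto
    then have "\<eta> (fst z) = 0" "\<eta>' (fst z) = 0" using supp \<Psi>(4) by auto
    then show ?thesis
      using \<Psi>(2,3)[of "fst z" "snd z"] by (cases "fst z \<in> {0<..<1}") (auto simp: weak_density_def indicator_def)
  qed
  \<comment> \<open>The times 0 and 1 lie outside [s',t'] since 0 \<le> s < s' and t' < t \<le>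
    1.\<close>
  have "\<eta> 0 = 0" "\<eta> 1 = 0" using supp st' st by auto
  then have "0 = (LINT z|spacetime. test_density 0 1 ?\<Psi> z)"
    using test_equation[OF \<Psi>(1)] by simp
  also have "\<dots> = (LINT z|spacetime. ?g z) + (LINT z|spacetime. \<eta> (fst z) * ?h z)"
    unfolding eq using g \<eta>h by (rule Bochner_Integration.integral_add)
  also have "(LINT z|spacetime. ?g z) = (LINT r:{s<..<t}|lborel. \<eta>' r * (LINT x|\<rho> r. sat e (f r x)))"
    using integral_spacetime_subinterval[OF st(1,3) g] by simp
  finally show ?thesis by linarith
qed

text \<open>As the cut-offs increase their plateau to (s,t), \<eta>' becomes a unit bump just after
  s minus one just before t. Continuity of G turns the left side of
  \<open>sat_cutoff_equation\<close> into G s - G t.\<close>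

lemma sat_equation:
  assumes e: "0 < e"
  shows "(LINT z|spacetime. weak_density s t (sat_dt f e) (sat_hessian f e) z) =
    (LINT x|\<rho> t. sat e (f t x)) - (LINT x|\<rho> s. sat e (f s x))"
proof -
  define G where "G r = (LINT x|\<rho> r. sat e (f r x))" for r
  define K where "K r = indicator {s<..<t} r * G r" for r
  let ?h = "weak_density s t (sat_dt f e) (sat_hessian f e)"
  have G: "continuous_on {s..t} G"
    unfolding G_def by (rule continuous_on_sat_integral[OF e])
  have K_meas: "K \<in> borel_measurable borel"
  proof -
    have "continuous_on {s<..<t} G" by (rule continuous_on_subset[OF G]) auto
    then have "(\<lambda>r. indicator {s<..<t} r *\<^sub>R G r) \<in> borel_measurable borel"
      by (intro borel_measurable_continuous_on_indicator) auto
    then show ?thesis by (simp add: K_def[abs_def])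
  qed
  obtain B where "\<forall>y\<in>G ` {s..t}. norm y \<le> B"
    using compact_imp_bounded[OF compact_continuous_image[OF G compact_Icc]] unfolding bounded_iff by blast
  then have B: "\<And>r. r \<in> {s..t} \<Longrightarrow> \<bar>G r\<bar> \<le> B" by simp
  have K_le: "\<bar>K r\<bar> \<le> \<bar>B\<bar>" for r
    using B[of r] by (auto simp: K_def indicator_def)
  \<comment> \<open>With N (t - s) > 3 the fall starts after s + 1/N and the rise is complete before
    t - 1/N, which gives the support property of \<eta>.\<close>
  obtain n0 where n0: "3 < real n0 * (t - s)"
    using reals_Archimedean3[of "t - s"] st(2) by auto
  define N where "N n = real n0 + real (Suc n)" for n
  have N: "0 < N n" "3 < N n * (t - s)" for n
  proof -
    show "0 < N n" by (simp add: N_def)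
    have "real n0 * (t - s) \<le> N n * (t - s)"
      using st(2) by (intro mult_right_mono) (auto simp: N_def)
    with n0 show "3 < N n * (t - s)" by linarith
  qed
  have N_lim: "filterlim N at_top sequentially"
    unfolding N_def by real_asymp
  \<comment> \<open>\<eta> rises over [s + 1/N, s + 2/N] and falls over [t - 2/N, t - 1/N]. The gaps
    of 1/N keep its support strictly inside (s,t).\<close>
  define \<eta> where "\<eta> n r = ramp (N n * (r - s) - 1) - ramp (N n * (r - t) - (- 2))" for n r
  define \<eta>' where "\<eta>' n r = N n * hat (N n * (r - s) - 1) - N n * hat (N n * (r - t) - (- 2))" for n r
  have d: "(\<eta> n has_real_derivative \<eta>' n r) (at r)" for n r
  proof -
    have "((\<lambda>r. ramp (N n * (r - u) - j)) has_real_derivative hat (N n * (r - u) - j) * N n) (at r)" for u j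
      by (rule DERIV_chain2[OF DERIV_ramp]) (auto intro!: derivative_eq_intros)
    from DERIV_diff[OF this[of s 1] this[of t "- 2"]] show ?thesis
      unfolding \<eta>_def[abs_def] \<eta>'_def by (simp add: mult.commute)
  qed
  have c: "continuous_on UNIV (\<eta>' n)" for n
    unfolding \<eta>'_def by (intro continuous_intros)
  have \<eta>_le: "\<bar>\<eta> n r\<bar> \<le> 1" for n r
    using ramp_bounds[of "N n * (r - s) - 1"] ramp_bounds[of "N n * (r - t) - (- 2)"] by (simp add: \<eta>_def)
  have \<eta>'_le: "\<bar>\<eta>' n r\<bar> \<le> N n * 2" for n r
  proof -
    have "N n * hat z \<le> N n * 2" "0 \<le> N n * hat z" for z
      using hat_bounds N(1)[of n] by (auto intro!: mult_left_mono)
    from this[of "N n * (r - s) - 1"] this[of "N n * (r - t) - (- 2)"] show ?thesis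
      unfolding \<eta>'_def by linarith
  qed
  have supp: "\<eta> n r = 0" if "r \<notin> {s + 1 / N n..t - 1 / N n}" for n r
  proof (cases "r < s + 1 / N n")
    case True
    then have 1: "N n * (r - s) - 1 \<le> 0" using N(1)[of n] by (simp add: field_simps)
    moreover have "N n * (r - t) = N n * (r - s) - N n * (t - s)" by (simp add: algebra_simps)
    ultimately have 2: "N n * (r - t) - (- 2) \<le> 0" using N(2)[of n] by linarith
    from 1 2 show ?thesis by (simp add: \<eta>_def ramp_eq_0)
  next
    case False
    with that have "t - 1 / N n < r" by auto
    then have 1: "1 \<le> N n * (r - t) - (- 2)" using N(1)[of n] by (simp add: field_simps)
    moreover have "N n * (r - t) = N n * (r - s) - N n * (t - s)" by (simp add: algebra_simps)
    ultimately have 2: "1 \<le> N n * (r - s) - 1" using N(2)[of n] by linarith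
    from 1 2 show ?thesis by (simp add: \<eta>_def ramp_eq_1)
  qed
  have eq: "(LINT r:{s<..<t}|lborel. \<eta>' n r * G r) = - (LINT z|spacetime. \<eta> n (fst z) * ?h z)" for n
    unfolding G_def
    by (rule sat_cutoff_equation[OF e d c \<eta>_le \<eta>'_le supp]) (use N(1)[of n] in auto)
  have hat_int: "integrable lborel (\<lambda>r. N n * hat (N n * (r - u) - j) * K r)" for n u j
  proof (rule Bochner_Integration.integrable_bound[where f = "\<lambda>r. indicator {s..t} r * (N n * 2 * \<bar>B\<bar>)"])
    show "integrable lborel (\<lambda>r. indicator {s..t} r * (N n * 2 * \<bar>B\<bar>) :: real)"
      using st(2) by (intro integrable_mult_left integrable_real_indicator) auto
    show "(\<lambda>r. N n * hat (N n * (r - u) - j) * K r) \<in> borel_measurable lborel"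
      using K_meas by measurable
    have "norm (N n * hat (N n * (r - u) - j) * K r) \<le> norm (indicator {s..t} r * (N n * 2 * \<bar>B\<bar>))" for r
    proof (cases "r \<in> {s..t}")
      case True
      have "\<bar>N n * hat (N n * (r - u) - j)\<bar> * \<bar>K r\<bar> \<le> (N n * 2) * \<bar>B\<bar>"
        using hat_bounds N(1)[of n] K_le[of r]
        by (intro mult_mono) (auto simp: abs_mult intro!: mult_left_mono)
      with True N(1)[of n] show ?thesis by (simp add: abs_mult)
    qed (auto simp: K_def indicator_def)
    then show "AE r in lborel. norm (N n * hat (N n * (r - u) - j) * K r) \<le> norm (indicator {s..t} r * (N n * 2 * \<bar>B\<bar>))"
      by simp
  qed
  have split: "(LINT r:{s<..<t}|lborel. \<eta>' n r * G r) =
      (LINT r|lborel. N n * hat (N n * (r - s) - 1) * K r) - (LINT r|lborel. N n * hat (N n * (r - t) - (- 2)) * K r)" for n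
    unfolding set_lebesgue_integral_def Bochner_Integration.integral_diff[OF hat_int hat_int, symmetric]
    by (intro Bochner_Integration.integral_cong) (auto simp: \<eta>'_def K_def algebra_simps)
  \<comment> \<open>At s and t the function K is 0 and not G; the shifted bumps sample only points
    inside (s,t), where the two agree.\<close>
  have ends: "(\<lambda>n. K (u + (j + z) / N n)) \<longlonglongrightarrow> G u"
    if u: "u \<in> {s..t}" and ev: "eventually (\<lambda>n. u + (j + z) / N n \<in> {s<..<t}) sequentially" for u j z
  proof -
    have "(\<lambda>n. (j + z) / N n) \<longlonglongrightarrow> 0"
      by (rule real_tendsto_divide_at_top[OF tendsto_const N_lim])
    then have "(\<lambda>n. u + (j + z) / N n) \<longlonglongrightarrow> u + 0" by (intro tendsto_intros)
    then have "(\<lambda>n. G (u + (j + z) / N n)) \<longlonglongrightarrow> G u"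
      using u ev by (intro continuous_on_tendsto_compose[OF G]) (auto elim!: eventually_mono)
    then show ?thesis
      by (rule Lim_transform_eventually) (use ev in \<open>auto elim!: eventually_mono simp: K_def\<close>)
  qed
  have lim_s: "(\<lambda>n. LINT r|lborel. N n * hat (N n * (r - s) - 1) * K r) \<longlonglongrightarrow> G s"
  proof (rule hat_approximate_identity[OF K_meas K_le N(1)])
    fix z :: real assume z: "0 < z" "z < 1"
    have "s + (1 + z) / N n \<in> {s<..<t}" for n
    proof -
      have "(1 + z) < N n * (t - s)" using N(2)[of n] z by linarith
      then show ?thesis using N(1)[of n] z by (auto simp: field_simps)
    qed
    then show "(\<lambda>n. K (s + (1 + z) / N n)) \<longlonglongrightarrow> G s" using st(2) by (intro ends) auto
  qed
  have lim_t: "(\<lambda>n. LINT r|lborel. N n * hat (N n * (r - t) - (- 2)) * K r) \<longlonglongrightarrow> G t"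
  proof (rule hat_approximate_identity[OF K_meas K_le N(1)])
    fix z :: real assume z: "0 < z" "z < 1"
    have "t + (- 2 + z) / N n \<in> {s<..<t}" for n
    proof -
      have "(2 - z) < N n * (t - s)" using N(2)[of n] z by linarith
      then show ?thesis using N(1)[of n] z by (auto simp: field_simps)
    qed
    then show "(\<lambda>n. K (t + (- 2 + z) / N n)) \<longlonglongrightarrow> G t" using st(2) by (intro ends) auto
  qed
  have h: "integrable spacetime ?h"
    using C(1) sat_dt_bound[OF f nonneg C e] sat_hessian_bound[OF f nonneg C e]
    by (intro weak_density_integrable[where C = "9 * C"] continuous_on_sat[OF f nonneg C e])
       (auto intro: order_trans[where y = C])
  have lim_h: "(\<lambda>n. LINT z|spacetime. \<eta> n (fst z) * ?h z) \<longlonglongrightarrow> (LINT z|spacetime. ?h z)"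
  proof (rule integral_dominated_convergence[where w = "\<lambda>z. norm (?h z)"])
    show "integrable spacetime (\<lambda>z. norm (?h z))" using h by simp
    show "(\<lambda>z. \<eta> n (fst z) * ?h z) \<in> borel_measurable spacetime" for n
    proof -
      have "continuous_on UNIV (\<eta> n)"
        using d by (meson DERIV_isCont continuous_at_imp_continuous_on)
      then have "(\<lambda>z. \<eta> n (fst z)) \<in> borel_measurable (borel :: (real \<times> (real^'n)) measure)"
        by (intro borel_measurable_continuous_onI continuous_on_compose2[OF _ continuous_on_fst[OF continuous_on_id]]) auto
      then show ?thesis using borel_measurable_integrable[OF h] by simp
    qed
    show "AE z in spacetime. norm (\<eta> n (fst z) * ?h z) \<le> norm (?h z)" for n
    proof (intro always_eventually allI)
      fix z show "norm (\<eta> n (fst z) * ?h z) \<le> norm (?h z)"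
        using mult_right_mono[OF \<eta>_le[of n "fst z"] abs_ge_zero[of "?h z"]] by (simp add: abs_mult)
    qed
    have "(\<lambda>n. \<eta> n (fst z) * ?h z) \<longlonglongrightarrow> ?h z" for z
    proof (cases "fst z \<in> {s<..<t}")
      case True
      have "filterlim (\<lambda>n. (fst z - s) * N n) at_top sequentially"
        using True by (intro filterlim_tendsto_pos_mult_at_top[OF tendsto_const _ N_lim]) auto
      then have 1: "eventually (\<lambda>n. 2 \<le> N n * (fst z - s)) sequentially"
        by (simp add: filterlim_at_top mult.commute)
      have "filterlim (\<lambda>n. (t - fst z) * N n) at_top sequentially"
        using True by (intro filterlim_tendsto_pos_mult_at_top[OF tendsto_const _ N_lim]) auto
      then have 2: "eventually (\<lambda>n. 2 \<le> N n * (t - fst z)) sequentially"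
        by (simp add: filterlim_at_top mult.commute)
      \<comment> \<open>Once both distances to the ends are at least 2/N, the time of z lies on the
        plateau where \<eta> is 1.\<close>
      have "eventually (\<lambda>n. \<eta> n (fst z) * ?h z = ?h z) sequentially"
        using 1 2
      proof eventually_elim
        case (elim n)
        have "N n * (fst z - t) = - (N n * (t - fst z))" by (simp add: algebra_simps)
        then have "N n * (fst z - t) - (- 2) \<le> 0" using elim(2) by linarith
        then show ?case using elim(1) by (simp add: \<eta>_def ramp_eq_0 ramp_eq_1)
      qed
      then show ?thesis by (rule tendsto_eventually)
    next
      case False
      then show ?thesis by (auto simp: weak_density_def indicator_def)
    qed
    then show "AE z in spacetime. (\<lambda>n. \<eta> n (fst z) * ?h z) \<longlonglongrightarrow> ?h z" by simp
  qed (use h in auto)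
  have "(\<lambda>n. LINT z|spacetime. \<eta> n (fst z) * ?h z) \<longlonglongrightarrow> - (G s - G t)"
    using tendsto_minus[OF tendsto_diff[OF lim_s lim_t]] eq unfolding split[symmetric] by simp
  from LIMSEQ_unique[OF lim_h this] show ?thesis by (simp add: G_def)
qed

text \<open>Let e = 1/(n+1) tend to 0. The densities are dominated by 9 C (1 + |A|) uniformly in e,
  and the end terms by f itself, integrable by quadratic growth and finite second moments.\<close>

lemma nonneg_equation:
  "(LINT z|spacetime. test_density s t f z) = (LINT x|\<rho> t. f t x) - (LINT x|\<rho> s. f s x)"
proof -
  let ?e = "\<lambda>n. 1 / real (Suc n)"
  have e: "0 < ?e n" for n by simp
  obtain M where M: "0 \<le> M" "\<And>r x. r \<in> {s..t} \<Longrightarrow> \<bar>f r x\<bar> \<le> M * (1 + (norm x)\<^sup>2)"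
    using C12b_quadratic_growth[OF f st(2)] by metis
  have lhs: "(\<lambda>n. LINT z|spacetime. weak_density s t (sat_dt f (?e n)) (sat_hessian f (?e n)) z) \<longlonglongrightarrow>
      (LINT z|spacetime. test_density s t f z)"
  proof (rule integral_dominated_convergence[OF _ _ bound_integrable[of "9 * C"]])
    show "test_density s t f \<in> borel_measurable spacetime"
      using test_density_integrable[OF f] by simp
    show "weak_density s t (sat_dt f (?e n)) (sat_hessian f (?e n)) \<in> borel_measurable spacetime" for n
      using weak_density_measurable[OF continuous_on_sat(4,5)[OF f nonneg C e]] by simp
    show "AE z in spacetime. norm (weak_density s t (sat_dt f (?e n)) (sat_hessian f (?e n)) z) \<le> 9 * C + 9 * C * norm (A z)" for n
    proof (intro always_eventually allI)
      fix z
      have "\<bar>weak_density s t (sat_dt f (?e n)) (sat_hessian f (?e n)) z\<bar> \<le> 9 * C + 9 * C * norm (A z)"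
      proof (rule weak_density_bound)
        show "\<bar>sat_dt f (?e n) z\<bar> \<le> 9 * C" if "z \<in> {s<..<t} \<times> UNIV" for z
          using sat_dt_bound[OF f nonneg C e that, of n] C(1) by linarith
      qed (use C(1) sat_hessian_bound[OF f nonneg C e] in auto)
      then show "norm (weak_density s t (sat_dt f (?e n)) (sat_hessian f (?e n)) z) \<le> 9 * C + 9 * C * norm (A z)" by simp
    qed
    have "(\<lambda>n. weak_density s t (sat_dt f (?e n)) (sat_hessian f (?e n)) z) \<longlonglongrightarrow> test_density s t f z" for z
    proof (cases "z \<in> {s<..<t} \<times> UNIV")
      case True
      then have f0: "0 \<le> f (fst z) (snd z)" by (intro nonneg) auto
      have "(\<lambda>n. weak_density s t (sat_dt f (?e n)) (sat_hessian f (?e n)) z) \<longlonglongrightarrow>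
        indicator ({s<..<t} \<times> UNIV) z * (1 * dt f (fst z) (snd z) + A z \<bullet> ((1/2) *\<^sub>R
          (1 *\<^sub>R hessian (f (fst z)) (snd z) + 0 *\<^sub>R outer (gradient (f (fst z)) (snd z)))))"
        unfolding weak_density_def sat_dt_def sat_hessian_def
        by (intro tendsto_intros sat_limits[OF f0])
      then show ?thesis by (simp add: weak_density_def)
    qed (simp add: weak_density_def)
    then show "AE z in spacetime. (\<lambda>n. weak_density s t (sat_dt f (?e n)) (sat_hessian f (?e n)) z) \<longlonglongrightarrow> test_density s t f z"
      by simp
  qed
  have rhs: "(\<lambda>n. LINT x|\<rho> r. sat (?e n) (f r x)) \<longlonglongrightarrow> (LINT x|\<rho> r. f r x)" if r: "r \<in> {s..t}" for r
  proof (rule integral_dominated_convergence[where w = "f r"])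
    have r1: "r \<in> {0..1}" using r st by auto
    show int: "integrable (\<rho> r) (f r)"
      using integrable_quadratic[OF r1 continuous_on_f_slice[OF r] M(2)[OF r]] .
    show "f r \<in> borel_measurable (\<rho> r)" using int by simp
    show "(\<lambda>x. sat (?e n) (f r x)) \<in> borel_measurable (\<rho> r)" for n
      using integrable_sat[OF e r r1] by blast
    show "AE x in \<rho> r. (\<lambda>n. sat (?e n) (f r x)) \<longlonglongrightarrow> f r x"
      using sat_limits(1)[OF nonneg[OF r]] by simp
    show "AE x in \<rho> r. norm (sat (?e n) (f r x)) \<le> f r x" for n
      using sat_bounds[OF e nonneg[OF r]] by (intro always_eventually allI) (simp only: real_norm_def abs_of_nonneg)
  qed
  have "(\<lambda>n. LINT z|spacetime. weak_density s t (sat_dt f (?e n)) (sat_hessian f (?e n)) z) \<longlonglongrightarrow>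
      (LINT x|\<rho> t. f t x) - (LINT x|\<rho> s. f s x)"
    unfolding sat_equation[OF e] using st(2) by (intro tendsto_diff rhs) auto
  from LIMSEQ_unique[OF lhs this] show ?thesis .
qed

end

text \<open>The shift q = M (1 + |x|^2) with M the growth constant makes \<psi> + q non-negative. As
  q is non-negative too, its own equation can be subtracted.\<close>

lemma subinterval_equation:
  assumes st: "0 \<le> s" "s < t" "t \<le> 1" and \<psi>: "C12b s t \<psi>"
  shows "(LINT z|spacetime. test_density s t \<psi> z) = (LINT x|\<rho> t. \<psi> t x) - (LINT x|\<rho> s. \<psi> s x)"
proof -
  obtain M where M: "0 \<le> M" "\<And>r x. r \<in> {s..t} \<Longrightarrow> \<bar>\<psi> r x\<bar> \<le> M * (1 + (norm x)\<^sup>2)"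
    using C12b_quadratic_growth[OF \<psi> st(2)] by metis
  define q :: "real \<Rightarrow> real^'n \<Rightarrow> real" where "q r x = M * (1 + (norm x)\<^sup>2)" for r x
  have q: "C12b s t q" unfolding q_def by (rule C12b_square_norm)
  let ?\<psi>q = "\<lambda>r x. \<psi> r x + q r x"
  note \<psi>q = C12b_add[OF \<psi> q]
  have eqn: "(LINT z|spacetime. test_density s t f z) = (LINT x|\<rho> t. f t x) - (LINT x|\<rho> s. f s x)"
    if f: "C12b s t f" "\<And>r x. r \<in> {s..t} \<Longrightarrow> 0 \<le> f r x" for f
  proof -
    obtain C where "0 < C" "\<And>r x. r \<in> {s<..<t} \<Longrightarrow> \<bar>dt f r x\<bar> \<le> C"
      "\<And>r x. r \<in> {s<..<t} \<Longrightarrow> norm (hessian (f r) x) \<le> C"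
      using C12b_bounds[OF f(1)] by metis
    then show ?thesis by (intro nonneg_equation[OF st f(1), where C = C] f(2))
  qed
  have dens: "test_density s t ?\<psi>q z = test_density s t \<psi> z + test_density s t q z" for z
    using \<psi>q(2,3)[of "fst z" "snd z"]
    by (cases "z \<in> {s<..<t} \<times> UNIV") (auto simp: weak_density_def algebra_simps inner_add_right mem_Times_iff)
  have slice: "(LINT x|\<rho> r. ?\<psi>q r x) = (LINT x|\<rho> r. \<psi> r x) + (LINT x|\<rho> r. q r x)" if r: "r \<in> {s..t}" for r
  proof (rule Bochner_Integration.integral_add)
    have r1: "r \<in> {0..1}" using r st by auto
    show "integrable (\<rho> r) (\<psi> r)"
      by (rule integrable_quadratic[OF r1 C12b_continuous_slice[OF \<psi> r] M(2)[OF r]])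
    show "integrable (\<rho> r) (q r)"
      using M(1) by (intro integrable_quadratic[OF r1, of _ M]) (auto simp: q_def[abs_def] intro!: continuous_intros)
  qed
  have "0 \<le> ?\<psi>q r x" if "r \<in> {s..t}" for r x
    using M(2)[OF that, of x] by (simp add: q_def)
  from eqn[OF \<psi>q(1) this]
  have "(LINT z|spacetime. test_density s t \<psi> z) + (LINT z|spacetime. test_density s t q z) =
      ((LINT x|\<rho> t. \<psi> t x) + (LINT x|\<rho> t. q t x)) - ((LINT x|\<rho> s. \<psi> s x) + (LINT x|\<rho> s. q s x))"
    using slice[of s] slice[of t] st(2) unfolding dens
    by (simp add: Bochner_Integration.integral_add[OF test_density_integrable[OF \<psi>] test_density_integrable[OF q]])
  moreover have "(LINT z|spacetime. test_density s t q z) = (LINT x|\<rho> t. q t x) - (LINT x|\<rho> s. q s x)"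
    using M(1) by (intro eqn[OF q]) (simp add: q_def)
  ultimately show ?thesis by linarith
qed

lemma FPE_solution_subinterval:
  assumes st: "0 \<le> s" "s \<le> t" "t \<le> 1"
  shows "FPE_solution s t \<rho> a"
proof -
  have sub: "{s<..<t} \<subseteq> {0<..<1}" "{s..t} \<subseteq> {0..1}" using st by auto
  have "(LINT r:{s<..<t}|lborel. LINT x|\<rho> r. dt \<psi> r x + trace (((1/2) *\<^sub>R a r x) ** hessian (\<psi> r) x)) =
      (LINT x|\<rho> t. \<psi> t x) - (LINT x|\<rho> s. \<psi> s x)" if \<psi>: "C12b s t \<psi>" for \<psi>
  proof (cases "s = t")
    \<comment> \<open>On the degenerate interval both sides are 0.\<close>
    case True
    then show ?thesis by (simp add: set_lebesgue_integral_def)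
  next
    case False
    then show ?thesis
      using subinterval_equation[OF st(1) _ st(3) \<psi>] integral_test_density[OF \<psi> st(1,3)] st(2) by simp
  qed
  moreover have "continuous_map (top_of_set {s..t}) P2_topology \<rho>"
    using cont sub(2) by (rule continuous_map_from_subtopology_mono)
  moreover have "(\<lambda>(r, x). a r x) \<in> borel_measurable (restrict_space borel ({s<..<t} \<times> UNIV))"
  proof (rule measurable_restrict_mono)
    show "(\<lambda>(r, x). a r x) \<in> borel_measurable (restrict_space borel ({0<..<1} \<times> UNIV))"
      using sol by (simp add: FPE_solution_def)
  qed (use sub in auto)
  moreover have "(\<integral>\<^sup>+r\<in>{s<..<t}. (\<integral>\<^sup>+x. ennreal (norm (a r x)) \<partial>\<rho> r) \<partial>lborel) < \<infinity>"
  proof -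
    have "(\<integral>\<^sup>+r\<in>{s<..<t}. (\<integral>\<^sup>+x. ennreal (norm (a r x)) \<partial>\<rho> r) \<partial>lborel) \<le>
        (\<integral>\<^sup>+r\<in>{0<..<1}. (\<integral>\<^sup>+x. ennreal (norm (a r x)) \<partial>\<rho> r) \<partial>lborel)"
      using sub(1) by (intro nn_integral_mono mult_left_mono) (auto simp: indicator_def)
    also have "\<dots> < \<infinity>" using sol by (simp add: FPE_solution_def)
    finally show ?thesis .
  qed
  moreover have "\<forall>r\<in>{s<..<t}. \<forall>x. a r x \<in> Sym_nonneg"
    using sol sub(1) by (auto simp: FPE_solution_def)
  ultimately show ?thesis unfolding FPE_solution_def by blast
qed

end

section \<open>Duality\<close>

lemma fenchel_young:
  "a \<in> Sym_nonneg \<Longrightarrow> ereal (trace (a ** u)) - c t x a \<le> cost_conj c t x u"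
  unfolding cost_conj_def by (rule SUP_upper)

lemma cost_real:
  assumes adm: "p_admissible p c" and t: "t \<in> {0<..<1}" and a: "a \<in> Sym_nonneg"
  shows "c t x a = ereal (real_of_ereal (c t x a))"
proof -
  obtain k K where "ereal (k * norm a powr p) \<le> c t x a" "c t x a \<le> ereal (K * norm a powr p)"
    using adm t a unfolding p_admissible_def by blast
  then show ?thesis by (cases "c t x a") auto
qed

context
  fixes c :: "('n::finite) cost" and p t :: real and x :: "real^'n"
  assumes p: "1 < p" and adm: "p_admissible p c" and lsc: "lsc_cost c" and t: "t \<in> {0<..<1}"
begin

lemma superlinear_cost:
  obtains k where "superlinear_lsc Sym_nonneg (\<lambda>a. real_of_ereal (c t x a)) p k"
proof -
  let ?F = "\<lambda>a. real_of_ereal (c t x a)"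
  note cost_real = cost_real[OF adm t]
  obtain k K where k: "0 < k" and bounds: "\<And>a. a \<in> Sym_nonneg \<Longrightarrow>
      ereal (k * norm a powr p) \<le> c t x a \<and> c t x a \<le> ereal (K * norm a powr p)"
    using adm t unfolding p_admissible_def by blast
  have lower: "k * norm a powr p \<le> ?F a" "?F a \<le> K * norm a powr p" if "a \<in> Sym_nonneg" for a
    using bounds[OF that] cost_real[OF that] by (metis ereal_less_eq(3))+
  show thesis
  proof (rule that, unfold_locales)
    \<comment> \<open>Both growth bounds are 0 at the zero matrix because
      \<open>0 powr p = 0\<close>.\<close>
    have "y = 0" if "k * norm (0 :: real^'n^'n) powr p \<le> y" "y \<le> K * norm (0 :: real^'n^'n) powr p" for y
      using that by simp
    from this[OF lower[OF zero_in_Sym_nonneg]] show "?F 0 = 0" .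
    show "?F ((1 - \<theta>) *\<^sub>R a + \<theta> *\<^sub>R b) < (1 - \<theta>) * ?F a + \<theta> * ?F b"
      if *: "a \<in> Sym_nonneg" "b \<in> Sym_nonneg" "a \<noteq> b" "0 < \<theta>" "\<theta> < 1" for a b \<theta>
    proof -
      have "(1 - \<theta>) *\<^sub>R a + \<theta> *\<^sub>R b \<in> Sym_nonneg"
        using * by (intro convexD[OF convex_Sym_nonneg]) auto
      note eqs = cost_real[OF this] cost_real[OF *(1)] cost_real[OF *(2)]
      have "c t x ((1 - \<theta>) *\<^sub>R a + \<theta> *\<^sub>R b) < ereal (1 - \<theta>) * c t x a + ereal \<theta> * c t x b"
        using adm t * unfolding p_admissible_def by auto
      then have "ereal (?F ((1 - \<theta>) *\<^sub>R a + \<theta> *\<^sub>R b)) < ereal (1 - \<theta>) * ereal (?F a) + ereal \<theta> * ereal (?F b)"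
        using eqs by metis
      then show ?thesis by simp
    qed
    show "eventually (\<lambda>b. y < ?F b) (at a within Sym_nonneg)"
      if *: "a \<in> Sym_nonneg" "y < ?F a" for a y
    proof -
      have "ereal y < c t x a"
        using *(2) cost_real[OF *(1)] by (metis less_ereal.simps(1))
      also have "c t x a \<le> Liminf (at a within Sym_nonneg) (c t x)"
        using lsc t *(1) unfolding lsc_cost_def by auto
      finally have "eventually (\<lambda>b. ereal y < c t x b) (at a within Sym_nonneg)"
        by (rule less_LiminfD)
      moreover have "eventually (\<lambda>b. b \<in> Sym_nonneg) (at a within Sym_nonneg)"
        by (simp add: eventually_at_filter)
      ultimately show ?thesis
        by eventually_elim (metis cost_real less_ereal.simps(1))
    qed
  qed (fact p k lower closed_Sym_nonneg convex_Sym_nonneg zero_in_Sym_nonneg)+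
qed

text \<open>The conjugate value is attained at the unique maximiser b, and the conjugate is
  differentiable with derivative b \<bullet> v on the whole matrix space. Restricting that
  derivative to \<open>Sym\<close> at a symmetric u identifies \<open>gradient_Sym\<close> with
  b.\<close>

lemma fenchel_equality:
  fixes u :: "real^'n^'n"
  assumes u: "u \<in> Sym" and a: "a = gradient_Sym (\<lambda>u. real_of_ereal (cost_conj c t x u)) u"
  shows "a \<in> Sym_nonneg" and "cost_conj c t x u = ereal (trace (a ** u)) - c t x a"
proof -
  let ?F = "\<lambda>a. real_of_ereal (c t x a)"
  note cost_real = cost_real[OF adm t]
  obtain k where "superlinear_lsc Sym_nonneg ?F p k" using superlinear_cost .
  then interpret superlinear_lsc Sym_nonneg ?F p k .
  have val: "ereal (trace (b ** w)) - c t x b = ereal (b \<bullet> w - ?F b)" if "b \<in> Sym_nonneg" for b w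
    by (subst cost_real[OF that]) (use that in \<open>simp add: trace_mult_Sym Sym_nonneg_def\<close>)
  have conj: "cost_conj c t x w = ereal (b \<bullet> w - ?F b)" if b: "maximizer w b" for w b
    unfolding cost_conj_def
  proof (rule antisym)
    show "(SUP a\<in>Sym_nonneg. ereal (trace (a ** w)) - c t x a) \<le> ereal (b \<bullet> w - ?F b)"
      using b by (intro SUP_least) (simp add: val maximizer_def)
    have "b \<in> Sym_nonneg" using b by (simp add: maximizer_def)
    from SUP_upper[OF this, of "\<lambda>a. ereal (trace (a ** w)) - c t x a"]
    show "ereal (b \<bullet> w - ?F b) \<le> (SUP a\<in>Sym_nonneg. ereal (trace (a ** w)) - c t x a)"
      by (simp only: val[OF \<open>b \<in> Sym_nonneg\<close>])
  qed
  obtain b where b: "maximizer u b" using ex_maximizer by blast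
  then have bS: "b \<in> Sym_nonneg" by (simp add: maximizer_def)
  have "real_of_ereal (cost_conj c t x w) = d \<bullet> w - ?F d" if "maximizer w d" for w d
    by (simp only: conj[OF that] real_of_ereal.simps)
  from conjugate_has_derivative[OF this b]
  have "((\<lambda>u. real_of_ereal (cost_conj c t x u)) has_derivative (\<lambda>v. b \<bullet> v)) (at u)" .
  then have "a = b"
    unfolding a using bS u by (intro gradient_Sym_eqI[OF _ _ has_derivative_at_withinI]) (auto simp: Sym_nonneg_def)
  then show "a \<in> Sym_nonneg" "cost_conj c t x u = ereal (trace (a ** u)) - c t x a"
    using bS conj[OF b] val[OF bS] by simp_all
qed

end

section \<open>Lower bound and attainment of the cost\<close>

text \<open>For integrable f, dropping the negative part only increases the integral; otherwise the
  Bochner integral is 0 by convention.\<close>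

lemma ennreal_integral_le_nn_integral:
  fixes f :: "'a \<Rightarrow> real"
  shows "ennreal (integral\<^sup>L M f) \<le> (\<integral>\<^sup>+x. ennreal (f x) \<partial>M)"
proof (cases "integrable M f")
  case True
  then have "integral\<^sup>L M f \<le> enn2real (\<integral>\<^sup>+x. ennreal (f x) \<partial>M)"
    by (simp add: real_lebesgue_integral_def)
  then have "ennreal (integral\<^sup>L M f) \<le> ennreal (enn2real (\<integral>\<^sup>+x. ennreal (f x) \<partial>M))"
    by (rule ennreal_leI)
  also have "\<dots> = (\<integral>\<^sup>+x. ennreal (f x) \<partial>M)"
    using True by (intro ennreal_enn2real) (auto simp: real_integrable_def top.not_eq_extremum)
  finally show ?thesis .
qed (simp add: not_integrable_integral_eq)

text \<open>The weak equation rewrites the boundary terms as an iterated Bochner integral, and the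
  previous lemma is used once in time and once in space. A competitor of infinite cost, or one whose
  integrand is not integrable, is thus covered as well.\<close>

lemma FPE_cost_ge:
  assumes sol: "FPE_solution s t \<rho> b" and \<phi>: "C12b s t \<phi>"
    and le: "\<And>r x. r \<in> {s<..<t} \<Longrightarrow>
      ereal (dt \<phi> r x + trace (((1/2) *\<^sub>R b r x) ** hessian (\<phi> r) x)) \<le> c r x (b r x)"
  shows "ennreal ((LINT x|\<rho> t. \<phi> t x) - (LINT x|\<rho> s. \<phi> s x)) \<le> FPE_cost c s t \<rho> b"
proof -
  let ?h = "\<lambda>r x. dt \<phi> r x + trace (((1/2) *\<^sub>R b r x) ** hessian (\<phi> r) x)"
  have "ennreal ((LINT x|\<rho> t. \<phi> t x) - (LINT x|\<rho> s. \<phi> s x)) = ennreal (LINT r:{s<..<t}|lborel. LINT x|\<rho> r. ?h r x)"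
    using sol \<phi> unfolding FPE_solution_def by simp
  also have "\<dots> \<le> (\<integral>\<^sup>+r. ennreal (indicator {s<..<t} r *\<^sub>R (LINT x|\<rho> r. ?h r x)) \<partial>lborel)"
    unfolding set_lebesgue_integral_def by (rule ennreal_integral_le_nn_integral)
  also have "\<dots> \<le> FPE_cost c s t \<rho> b"
    unfolding FPE_cost_def
  proof (rule nn_integral_mono)
    fix r :: real
    show "ennreal (indicator {s<..<t} r *\<^sub>R (LINT x|\<rho> r. ?h r x)) \<le>
        (\<integral>\<^sup>+x. e2ennreal (c r x (b r x)) \<partial>\<rho> r) * indicator {s<..<t} r"
    proof (cases "r \<in> {s<..<t}")
      case True
      have "ennreal (LINT x|\<rho> r. ?h r x) \<le> (\<integral>\<^sup>+x. ennreal (?h r x) \<partial>\<rho> r)"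
        by (rule ennreal_integral_le_nn_integral)
      also have "\<dots> \<le> (\<integral>\<^sup>+x. e2ennreal (c r x (b r x)) \<partial>\<rho> r)"
        using e2ennreal_mono[OF le[OF True]] by (intro nn_integral_mono) simp
      finally show ?thesis using True by simp
    qed simp
  qed
  finally show ?thesis .
qed

text \<open>Equality needs true integrability. The test density is integrable on space-time and
  non-negative, being equal to the cost on (s,t), so its non-negative integral and its Bochner
  integral coincide.\<close>

lemma (in FPE_curve) FPE_cost_eq:
  assumes st: "0 \<le> s" "s \<le> t" "t \<le> 1" and \<phi>: "C12b s t \<phi>"
    and eq: "\<And>r x. r \<in> {s<..<t} \<Longrightarrow>
      c r x (a r x) = ereal (dt \<phi> r x + trace (((1/2) *\<^sub>R a r x) ** hessian (\<phi> r) x))"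
    and nonneg: "\<And>r x. r \<in> {s<..<t} \<Longrightarrow> 0 \<le> c r x (a r x)"
  shows "FPE_cost c s t \<rho> a = ennreal ((LINT x|\<rho> t. \<phi> t x) - (LINT x|\<rho> s. \<phi> s x))"
proof -
  have r01: "r \<in> {0<..<1}" if "r \<in> {s<..<t}" for r using that st by auto
  have dens: "test_density s t \<phi> (r, x) = dt \<phi> r x + trace (((1/2) *\<^sub>R a r x) ** hessian (\<phi> r) x)"
    if "r \<in> {s<..<t}" for r x
    using that by (simp add: weak_density_def trace_mult_half_Sym[OF a_Sym[OF r01]] A_eq[OF r01])
  have dens_nonneg: "0 \<le> test_density s t \<phi> z" for z
  proof (cases "z \<in> {s<..<t} \<times> UNIV")
    case True
    then have "fst z \<in> {s<..<t}" by auto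
    with eq[OF this, of "snd z"] nonneg[OF this, of "snd z"] dens[OF this, of "snd z"] show ?thesis by simp
  qed (simp add: weak_density_def)
  have meas: "test_density s t \<phi> \<in> borel_measurable borel"
    using borel_measurable_integrable[OF test_density_integrable[OF \<phi>]] by simp
  have "FPE_cost c s t \<rho> a = (\<integral>\<^sup>+r\<in>{0<..<1}. (\<integral>\<^sup>+x. ennreal (test_density s t \<phi> (r, x)) \<partial>\<rho> r) \<partial>lborel)"
    unfolding FPE_cost_def
  proof (rule nn_integral_cong)
    fix r :: real
    show "(\<integral>\<^sup>+x. e2ennreal (c r x (a r x)) \<partial>\<rho> r) * indicator {s<..<t} r =
        (\<integral>\<^sup>+x. ennreal (test_density s t \<phi> (r, x)) \<partial>\<rho> r) * indicator {0<..<1} r"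
    proof (cases "r \<in> {s<..<t}")
      case True
      then show ?thesis using r01[OF True] by (simp only: eq[OF True] dens[OF True] e2ennreal_ereal indicator_simps)
    next
      case False
      then show ?thesis by (simp add: weak_density_def)
    qed
  qed
  also have "\<dots> = (\<integral>\<^sup>+z. ennreal (test_density s t \<phi> z) \<partial>spacetime)"
    using meas by (intro nn_integral_spacetime[symmetric]) simp
  also have "\<dots> = ennreal (LINT z|spacetime. test_density s t \<phi> z)"
    using test_density_integrable[OF \<phi>] dens_nonneg by (intro nn_integral_eq_integral) auto
  also have "(LINT z|spacetime. test_density s t \<phi> z) = (LINT x|\<rho> t. \<phi> t x) - (LINT x|\<rho> s. \<phi> s x)"
    using FPE_solution_subinterval[OF st] \<phi> integral_test_density[OF \<phi> st(1,3)] unfolding FPE_solution_def by simp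
  finally show ?thesis .
qed

theorem corollary4p6:
  fixes c :: "('n::finite) cost"
    and p :: real
    and \<phi> :: "real \<Rightarrow> real^'n \<Rightarrow> real"
    and \<rho> :: "real \<Rightarrow> (real^'n) measure"
    and a :: "real \<Rightarrow> real^'n \<Rightarrow> real^'n^'n"
  assumes "1 < p"
    and "borel_cost c"
    and "p_admissible p c"
    and "lsc_cost c"
    and "C12b 0 1 \<phi>"
    and "\<And>t x. t \<in> {0<..<1} \<Longrightarrow>
      ereal (dt \<phi> t x) = - cost_conj c t x ((1/2) *\<^sub>R hessian (\<phi> t) x)"
    and "\<And>t x. t \<in> {0<..<1} \<Longrightarrow>
      a t x = gradient_Sym (\<lambda>u. real_of_ereal (cost_conj c t x u)) ((1/2) *\<^sub>R hessian (\<phi> t) x)"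
    and "FPE_solution 0 1 \<rho> a"
  shows "is_arg_min (\<lambda>(\<rho>', a'). FPE_cost c 0 1 \<rho>' a') (FPE_competitor 0 1 (\<rho> 0) (\<rho> 1)) (\<rho>, a)
    \<and> (\<forall>s t. 0 \<le> s \<and> s \<le> t \<and> t \<le> 1 \<longrightarrow>
          c_FPE c s t (\<rho> s) (\<rho> t) = FPE_cost c s t \<rho> a)"
proof -
  note \<phi> = assms(5) and HJ = assms(6) and grad = assms(7)
  interpret FPE_curve \<rho> a using assms(8) by unfold_locales
  have \<phi>_st: "C12b s t \<phi>" if "0 \<le> s" "t \<le> 1" for s t
    using C12b_subinterval[OF \<phi> that] .
  \<comment> \<open>The equation equates a real number with minus the conjugate, so the conjugate is
    finite at these points.\<close>
  have dt: "cost_conj c r x ((1/2) *\<^sub>R hessian (\<phi> r) x) = ereal (- dt \<phi> r x)" if "r \<in> {0<..<1}" for r x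
    using HJ[OF that, of x] by (metis ereal_uminus_eq_reorder uminus_ereal.simps(1))
  have tr: "trace (b ** ((1/2) *\<^sub>R u)) = trace (((1/2) *\<^sub>R b) ** u)" if "b \<in> Sym_nonneg" for b u :: "real^'n^'n"
    using that by (simp add: trace_mult_half_Sym trace_mult_Sym Sym_nonneg_def)
  \<comment> \<open>Fenchel-Young at u equal to half the Hessian, with the conjugate replaced by
    minus the time derivative.\<close>
  have le: "ereal (dt \<phi> r x + trace (((1/2) *\<^sub>R b) ** hessian (\<phi> r) x)) \<le> c r x b"
    if r: "r \<in> {0<..<1}" and b: "b \<in> Sym_nonneg" for r x b
    using fenchel_young[OF b, of "(1/2) *\<^sub>R hessian (\<phi> r) x" c r x] unfolding dt[OF r] tr[OF b]
    by (cases "c r x b") auto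
  have a_eq: "c r x (a r x) = ereal (dt \<phi> r x + trace (((1/2) *\<^sub>R a r x) ** hessian (\<phi> r) x))"
    if r: "r \<in> {0<..<1}" for r x
  proof -
    have "(1/2) *\<^sub>R hessian (\<phi> r) x \<in> Sym"
      using C12b_hessian_Sym[OF \<phi> r] by (simp add: Sym_def transpose_scalar)
    note fe = fenchel_equality[OF assms(1,3,4) r this grad[OF r]]
    show ?thesis
      using fe(2) unfolding dt[OF r] tr[OF fe(1)] by (cases "c r x (a r x)") auto
  qed
  have c_nonneg: "0 \<le> c r x b" if "r \<in> {0<..<1}" "b \<in> Sym_nonneg" for r x b
  proof -
    obtain k K where "0 < k" and "\<forall>t\<in>{0<..<1}. \<forall>x. \<forall>a\<in>Sym_nonneg.
        ereal (k * norm a powr p) \<le> c t x a \<and> c t x a \<le> ereal (K * norm a powr p)"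
      using assms(3) unfolding p_admissible_def by blast
    then have "0 < k" "ereal (k * norm b powr p) \<le> c r x b"
      using that by blast+
    then show ?thesis by (meson ereal_less_eq(5) less_imp_le mult_nonneg_nonneg order_trans powr_ge_zero)
  qed
  have a_nonneg: "a r x \<in> Sym_nonneg" if "r \<in> {0<..<1}" for r x
    using sol that by (simp add: FPE_solution_def)
  \<comment> \<open>Both costs are compared with the same number: the boundary term depends only on
    the end measures, which every competitor shares.\<close>
  have min: "FPE_cost c s t \<rho> a \<le> FPE_cost c s t \<rho>' a'"
    if st: "0 \<le> s" "s \<le> t" "t \<le> 1" and comp: "FPE_competitor s t (\<rho> s) (\<rho> t) (\<rho>', a')" for s t \<rho>' a'
  proof -
    have r01: "r \<in> {0<..<1}" if "r \<in> {s<..<t}" for r using that st by auto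
    have sol': "FPE_solution s t \<rho>' a'" and ends: "\<rho>' s = \<rho> s" "\<rho>' t = \<rho> t"
      using comp by (simp_all add: FPE_competitor_def)
    have "FPE_cost c s t \<rho> a = ennreal ((LINT x|\<rho> t. \<phi> t x) - (LINT x|\<rho> s. \<phi> s x))"
      by (intro FPE_cost_eq[OF st \<phi>_st[OF st(1,3)]] a_eq c_nonneg a_nonneg r01)
    also have "\<dots> \<le> FPE_cost c s t \<rho>' a'"
    proof (rule FPE_cost_ge[OF sol' \<phi>_st[OF st(1,3)], unfolded ends])
      fix r x assume r: "r \<in> {s<..<t}"
      then have "a' r x \<in> Sym_nonneg" using sol' unfolding FPE_solution_def by auto
      with r01[OF r] show "ereal (dt \<phi> r x + trace (((1/2) *\<^sub>R a' r x) ** hessian (\<phi> r) x)) \<le> c r x (a' r x)"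
        by (rule le)
    qed
    finally show ?thesis .
  qed
  \<comment> \<open>Localisation makes the given pair admissible on [s,t], so the infimum is
    attained there.\<close>
  have self: "FPE_competitor s t (\<rho> s) (\<rho> t) (\<rho>, a)" if "0 \<le> s" "s \<le> t" "t \<le> 1" for s t
    using FPE_solution_subinterval[OF that] by (simp add: FPE_competitor_def)
  have "is_arg_min (\<lambda>(\<rho>', a'). FPE_cost c 0 1 \<rho>' a') (FPE_competitor 0 1 (\<rho> 0) (\<rho> 1)) (\<rho>, a)"
    using self[of 0 1] min[of 0 1] by (auto simp: is_arg_min_def not_less)
  moreover have "c_FPE c s t (\<rho> s) (\<rho> t) = FPE_cost c s t \<rho> a" if st: "0 \<le> s" "s \<le> t" "t \<le> 1" for s t
    unfolding c_FPE_def
  proof (rule antisym)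
    show "(INF (\<rho>', a')\<in>Collect (FPE_competitor s t (\<rho> s) (\<rho> t)). FPE_cost c s t \<rho>' a') \<le> FPE_cost c s t \<rho> a"
      using self[OF st] by (intro INF_lower2[of "(\<rho>, a)"]) auto
    show "FPE_cost c s t \<rho> a \<le> (INF (\<rho>', a')\<in>Collect (FPE_competitor s t (\<rho> s) (\<rho> t)). FPE_cost c s t \<rho>' a')"
      using min[OF st] by (intro INF_greatest) auto
  qed
  ultimately show ?thesis by blast
qed

end
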